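(* For every integer $n\geq 2$, the derangement descent polynomial $$D_n(t)=\sum_{\pi\in\mathfrak D_n}t^{\operatorname{des}(\pi)}$$ has only nonpositive real zeros (that is, every complex zero of $D_n$ is real and $\leq 0$).
   Context: $\mathfrak S_n$ denotes the symmetric group on $\{1,\dots,n\}$, with permutations written in one-line notation $\pi=\pi_1\cdots\pi_n$. $\mathfrak D_n\subseteq\mathfrak S_n$ is the set of derangements, i.e. permutations with $\pi_i\neq i$ for all $i$. $\operatorname{des}(\pi)$ is the number of indices $1\leq i<n$ with $\pi_i>\pi_{i+1}$. *)

theory Defs
  imports Complex_Main "HOL-Combinatorics.Permutations" "HOL-Computational_Algebra.Polynomial"
begin

(* A permutation of {1..n} is a function p with p permutes {1..n} (the identity outside {1..n});
   its one-line notation is p 1, ..., p n. *)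

definition derangements :: "nat \<Rightarrow> (nat \<Rightarrow> nat) set" where
  "derangements n = {p. p permutes {1..n} \<and> (\<forall>i\<in>{1..n}. p i \<noteq> i)}"

definition des :: "nat \<Rightarrow> (nat \<Rightarrow> nat) \<Rightarrow> nat" where
  "des n p = card {i. 1 \<le> i \<and> i < n \<and> p i > p (i + 1)}"

definition derangement_descent_poly :: "nat \<Rightarrow> 'a::comm_semiring_1 poly" where
  "derangement_descent_poly n = (\<Sum>p\<in>derangements n. monom 1 (des n p))"

end

theory Submission
  imports Defs "HOL-Library.FuncSet" "HOL-Complex_Analysis.Complex_Analysis"
    "HOL-Computational_Algebra.Fundamental_Theorem_Algebra"
begin

text \<open>
  Counting words over an alphabet of size \<open>m\<close> by the fixed points of their standardization gives, for
  \<open>f n m = (\<Sum>\<pi>. (m + n - 1 - des \<pi>) choose n)\<close> with \<open>\<pi>\<close> ranging over the derangements of \<open>{1..n}\<close>, the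
  recurrence \<open>f (n + 1) m = m * f n m + (- 1) ^ (n + 1) * (m choose (n + 1))\<close>: a letter that is a fixed
  point can be deleted, and the deleted letter can be put back in exactly one way.
  Put \<open>w = x + 1\<close> and \<open>\<phi> n = (\<Sum>\<pi>. x ^ (n - 1 - des \<pi>) * w ^ (des \<pi> + 1))\<close>. The recurrence becomes
  \<open>\<phi> (n + 1) = w * (x * \<phi> n)' + (- w) ^ (n + 1)\<close>, and eliminating the last term yields
  \<open>\<phi> (n + 2) = \<nu> (\<phi> (n + 1)) + \<beta> (\<phi> n)\<close> with \<open>\<nu> f = x * w * f'\<close> and \<open>\<beta> f = w\<^sup>2 * (x * f)'\<close>.

  Write \<open>p \<lless> q\<close> if \<open>Im (q / p) \<ge> 0\<close> on the upper half plane. This relation is additive in both arguments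
  and passes to derivatives by the Gauss-Lucas theorem. For every \<open>f\<close> with all roots in \<open>[- 1, 0]\<close> and
  every \<open>j\<close> one has \<open>\<beta> ^ (j + 1) f \<lless> \<nu> (\<beta> ^ j (\<nu> f))\<close> and \<open>\<beta> ^ (j + 1) (\<nu> f) \<lless> \<nu> (\<beta> ^ j (\<beta> f))\<close>. Expanding
  \<open>\<phi> (n + 1)\<close> and \<open>\<phi> n\<close> by the recurrence then gives \<open>\<beta> ^ (j + 1) (\<phi> n) \<lless> \<nu> (\<beta> ^ j (\<phi> (n + 1)))\<close> for all \<open>j\<close> by
  induction on \<open>n\<close>, the induction hypothesis being used with \<open>j + 1\<close>. The case \<open>j = 0\<close> shows that the two
  summands of \<open>\<phi> (n + 2)\<close> interlace, so \<open>\<phi> (n + 2)\<close> has only real roots.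
\<close>

section \<open>The Gauss-Lucas theorem\<close>

text \<open>Partial fractions of the logarithmic derivative, with \<open>r\<close> listing the roots
  by multiplicity. Both \<open>Gauss_Lucas\<close> and \<open>strip_pair_nuop\<close> start from
  this sum.\<close>

lemma log_pderiv_complex:
  fixes p :: "complex poly"
  obtains r where "\<And>i. i < degree p \<Longrightarrow> poly p (r i) = 0"
    and "\<And>w. poly p w \<noteq> 0 \<Longrightarrow> poly (pderiv p) w = poly p w * (\<Sum>i<degree p. 1 / (w - r i))"
proof -
  obtain r where r: "smult (lead_coeff p) (\<Prod>i<degree p. [:- r i, 1:]) = p"
    by (rule complex_poly_decompose')
  have eval: "poly p w = lead_coeff p * (\<Prod>i<degree p. w - r i)" for w
    by (subst r [symmetric]) (simp add: poly_prod)
  show ?thesis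
  proof
    show "poly p (r i) = 0" if "i < degree p" for i
      using that by (subst eval) auto
    show "poly (pderiv p) w = poly p w * (\<Sum>i<degree p. 1 / (w - r i))" if "poly p w \<noteq> 0" for w
    proof -
      have nz: "w - r i \<noteq> 0" if "i < degree p" for i
        using \<open>poly p w \<noteq> 0\<close> that eval by auto
      have "pderiv p = smult (lead_coeff p) (\<Sum>i<degree p. \<Prod>j\<in>{..<degree p} - {i}. [:- r j, 1:])"
        by (subst r [symmetric]) (simp add: pderiv_smult pderiv_prod pderiv_pCons)
      then have "poly (pderiv p) w = lead_coeff p * (\<Sum>i<degree p. \<Prod>j\<in>{..<degree p} - {i}. w - r j)"
        by (simp add: poly_sum poly_prod)
      also have "(\<Sum>i<degree p. \<Prod>j\<in>{..<degree p} - {i}. w - r j)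
          = (\<Sum>i<degree p. (\<Prod>j<degree p. w - r j) * (1 / (w - r i)))"
      proof (intro sum.cong refl)
        fix i assume i: "i \<in> {..<degree p}"
        have "(\<Prod>j<degree p. w - r j) = (w - r i) * (\<Prod>j\<in>{..<degree p} - {i}. w - r j)"
          using i by (intro prod.remove) auto
        then show "(\<Prod>j\<in>{..<degree p} - {i}. w - r j) = (\<Prod>j<degree p. w - r j) * (1 / (w - r i))"
          using nz i by (simp add: field_simps)
      qed
      finally show ?thesis
        by (simp add: eval [of w] sum_distrib_left mult.assoc)
    qed
  qed
qed

text \<open>If \<open>p\<close> does not vanish at \<open>w\<close>, the terms
  \<open>1 / (w - r i)\<close> sum to 0. Conjugation turns each into a positive multiple of
  \<open>w - r i\<close>, which makes \<open>w\<close> a convex combination of the roots.\<close>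

theorem Gauss_Lucas:
  fixes p :: "complex poly"
  assumes "convex S" and roots: "\<And>z. poly p z = 0 \<Longrightarrow> z \<in> S"
    and "degree p > 0" and w: "poly (pderiv p) w = 0"
  shows "w \<in> S"
proof (cases "poly p w = 0")
  case False
  obtain r where r: "\<And>i. i < degree p \<Longrightarrow> poly p (r i) = 0"
    and s: "\<And>w. poly p w \<noteq> 0 \<Longrightarrow> poly (pderiv p) w = poly p w * (\<Sum>i<degree p. 1 / (w - r i))"
    using log_pderiv_complex [of p] by metis
  define a where "a i = 1 / (cmod (w - r i))\<^sup>2" for i
  define A where "A = (\<Sum>i<degree p. a i)"
  have nz: "w \<noteq> r i" if "i < degree p" for i
    using False r that by auto
  have apos: "a i > 0" if "i < degree p" for i
    using nz that by (simp add: a_def)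
  have Apos: "A > 0"
    unfolding A_def using \<open>degree p > 0\<close> apos by (intro sum_pos) auto
  have inv: "1 / (w - r i) = cnj (a i *\<^sub>R (w - r i))" if "i < degree p" for i
    using complex_div_cnj[of 1 "w - r i"]
    by (simp add: a_def scaleR_conv_of_real field_simps)
  have "(\<Sum>i<degree p. 1 / (w - r i)) = 0"
    using s [OF False] w False by simp
  also have "(\<Sum>i<degree p. 1 / (w - r i)) = cnj (\<Sum>i<degree p. a i *\<^sub>R (w - r i))"
    unfolding cnj_sum by (intro sum.cong refl inv) auto
  finally have "(\<Sum>i<degree p. a i *\<^sub>R (w - r i)) = 0"
    by (simp only: complex_cnj_zero_iff)
  then have "A *\<^sub>R w = (\<Sum>i<degree p. a i *\<^sub>R r i)"
    by (simp add: A_def scaleR_right_diff_distrib sum_subtractf scaleR_sum_left)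
  then have "(\<Sum>i<degree p. (a i / A) *\<^sub>R r i) = (1 / A) *\<^sub>R A *\<^sub>R w"
    by (simp add: scaleR_sum_right divide_inverse mult.commute)
  also have "\<dots> = w"
    using Apos by simp
  finally have w_eq: "w = (\<Sum>i<degree p. (a i / A) *\<^sub>R r i)" ..
  show ?thesis
    unfolding w_eq
  proof (rule convex_sum)
    show "(\<Sum>i<degree p. a i / A) = 1"
      using Apos by (simp add: A_def flip: sum_divide_distrib)
  qed (use assms r Apos apos in \<open>auto simp: less_imp_le\<close>)
qed (use roots in auto)

section \<open>Interlacing on the upper half plane\<close>

definition real_poly :: "complex poly \<Rightarrow> bool" where
  "real_poly p \<longleftrightarrow> (\<forall>i. coeff p i \<in> \<real>)"

lemma real_poly_0 [simp]: "real_poly 0" and real_poly_1 [simp]: "real_poly 1"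
  by (auto simp: real_poly_def)

lemma real_poly_pCons [simp]: "real_poly (pCons a p) \<longleftrightarrow> a \<in> \<real> \<and> real_poly p"
  by (auto simp: real_poly_def coeff_pCons split: nat.splits)

lemma real_poly_add: "real_poly p \<Longrightarrow> real_poly q \<Longrightarrow> real_poly (p + q)"
  by (auto simp: real_poly_def)

lemma real_poly_mult: "real_poly p \<Longrightarrow> real_poly q \<Longrightarrow> real_poly (p * q)"
  by (auto simp: real_poly_def coeff_mult intro!: sum_in_Reals)

lemma real_poly_power: "real_poly p \<Longrightarrow> real_poly (p ^ n)"
  by (induction n) (auto intro: real_poly_mult)

lemma real_poly_pderiv: "real_poly p \<Longrightarrow> real_poly (pderiv p)"
  by (auto simp: real_poly_def coeff_pderiv simp del: of_nat_Suc)

lemma real_poly_cnj: "real_poly p \<Longrightarrow> poly p (cnj z) = cnj (poly p z)"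
  by (simp add: real_poly_def poly_cnj_real)

lemma real_poly_Im: "real_poly p \<Longrightarrow> Im z = 0 \<Longrightarrow> Im (poly p z) = 0"
  by (metis Reals_cnj_iff complex_is_Real_iff real_poly_cnj)

text \<open>The sign of \<open>cross a b\<close> is that of \<open>Im (b / a)\<close>; unlike the quotient it is additive in both arguments.\<close>
definition cross :: "complex \<Rightarrow> complex \<Rightarrow> real" where
  "cross a b = Im (b * cnj a)"

lemma cross_add_left: "cross (a + b) c = cross a c + cross b c"
  and cross_add_right: "cross a (b + c) = cross a b + cross a c"
  by (simp_all add: cross_def algebra_simps)

lemma cross_0_left [simp]: "cross 0 a = 0" and cross_0_right [simp]: "cross a 0 = 0"
  and cross_self [simp]: "cross a a = 0" and cross_1_left [simp]: "cross 1 a = Im a"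
  and cross_1_right [simp]: "cross a 1 = - Im a"
  by (simp_all add: cross_def)

lemma cross_mult: "cross (a * s) (b * s) = cross a b * (cmod s)\<^sup>2"
  unfolding cmod_power2 by (simp add: cross_def power2_eq_square algebra_simps)

lemma cross_mult_self: "cross s (c * s) = Im c * (cmod s)\<^sup>2"
  using cross_mult [of 1 s c] by simp

text \<open>The relation \<lless> of the overview. The inequality is weak and free of quotients, so
  0 is related to everything and zeros of \<open>p\<close> need no exception.\<close>

definition interl :: "complex poly \<Rightarrow> complex poly \<Rightarrow> bool" where
  "interl p q \<longleftrightarrow> (\<forall>z. Im z > 0 \<longrightarrow> 0 \<le> cross (poly p z) (poly q z))"

lemma interl_0_left [simp]: "interl 0 q" and interl_0_right [simp]: "interl p 0"
  by (auto simp: interl_def)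

lemma interl_add_left: "interl p r \<Longrightarrow> interl q r \<Longrightarrow> interl (p + q) r"
  by (auto simp: interl_def cross_add_left)

lemma interl_add_right: "interl p q \<Longrightarrow> interl p r \<Longrightarrow> interl p (q + r)"
  by (auto simp: interl_def cross_add_right)

lemma interl_refl: "interl p p"
  by (auto simp: interl_def)

lemma interl_mult: "interl p q \<Longrightarrow> interl (p * s) (q * s)"
  by (auto simp: interl_def cross_mult)

lemma convex_Im_le_0: "convex {z. Im z \<le> 0}"
  by (rule convex_halfspace_Im_le)

text \<open>If the quotient \<open>c\<close> of the derivatives at \<open>z\<close> had negative
  imaginary part, \<open>q - smult c p\<close> would have no root in the upper half plane, and by
  Gauss-Lucas its critical point \<open>z\<close> could not lie there either.\<close>

lemma interl_pderiv:
  assumes pq: "interl p q" and real: "real_poly p" "real_poly q"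
    and roots: "\<And>z. poly p z = 0 \<Longrightarrow> Im z = 0"
  shows "interl (pderiv p) (pderiv q)"
  unfolding interl_def
proof (intro allI impI)
  fix z :: complex
  assume z: "0 < Im z"
  show "0 \<le> cross (poly (pderiv p) z) (poly (pderiv q) z)"
  proof (cases "poly (pderiv p) z = 0")
    case False
    define c where "c = poly (pderiv q) z / poly (pderiv p) z"
    have qz: "poly (pderiv q) z = c * poly (pderiv p) z"
      using False by (simp add: c_def)
    have "Im c \<ge> 0"
    proof (rule ccontr)
      assume "\<not> Im c \<ge> 0"
      define s where "s = q - smult c p"
      have s_roots: "Im \<zeta> \<le> 0" if "poly s \<zeta> = 0" for \<zeta>
      proof (rule ccontr)
        assume \<zeta>: "\<not> Im \<zeta> \<le> 0"
        have "poly q \<zeta> = c * poly p \<zeta>"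
          using that by (simp add: s_def)
        then have "0 \<le> Im c * (cmod (poly p \<zeta>))\<^sup>2"
          using pq \<zeta> by (auto simp: interl_def cross_mult_self dest: spec [of _ \<zeta>])
        moreover have "poly p \<zeta> \<noteq> 0"
          using roots \<zeta> by force
        ultimately show False
          using \<open>\<not> Im c \<ge> 0\<close> by (simp add: zero_le_mult_iff)
      qed
      have ds: "poly (pderiv s) z = 0"
        by (simp add: s_def pderiv_diff pderiv_smult qz)
      show False
      proof (cases "degree s = 0")
        case True
        \<comment> \<open>Gauss-Lucas does not cover a constant \<open>s\<close>. Here the
          derivatives are proportional, so \<open>c\<close> is a quotient of real
          coefficients.\<close>
        then have "pderiv q = smult c (pderiv p)"
          by (simp add: s_def pderiv_diff pderiv_smult flip: pderiv_eq_0_iff)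
        then have "lead_coeff (pderiv p) * c = coeff (pderiv q) (degree (pderiv p))"
          by simp
        moreover have "pderiv p \<noteq> 0"
          using False by auto
        ultimately have "c = coeff (pderiv q) (degree (pderiv p)) / lead_coeff (pderiv p)"
          by (simp add: field_simps)
        also have "\<dots> \<in> \<real>"
          using real [THEN real_poly_pderiv] by (auto simp: real_poly_def intro: Reals_divide)
        finally show False
          using \<open>\<not> Im c \<ge> 0\<close> by (auto simp: complex_is_Real_iff)
      next
        case False
        then have "z \<in> {z. Im z \<le> 0}"
          using Gauss_Lucas [OF convex_Im_le_0 _ _ ds] s_roots by auto
        then show False
          using z by simp
      qed
    qed
    then show ?thesis
      by (simp add: qz cross_mult_self)
  qed auto
qed

text \<open>The map \<open>1 + 1 / x\<close> sends [-1, 0) onto the nonpositive half line, so zeros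
  in this segment become nonpositive zeros of the descent polynomial.\<close>

definition unit_seg :: "complex set" where
  "unit_seg = {z. Im z = 0 \<and> - 1 \<le> Re z \<and> Re z \<le> 0}"

definition rooted :: "complex poly \<Rightarrow> bool" where
  "rooted p \<longleftrightarrow> real_poly p \<and> p \<noteq> 0 \<and> (\<forall>z. poly p z = 0 \<longrightarrow> z \<in> unit_seg)"

lemma convex_unit_seg: "convex unit_seg"
proof -
  have "unit_seg = {z. Im z \<le> 0} \<inter> {z. Im z \<ge> 0} \<inter> {z. Re z \<ge> - 1} \<inter> {z. Re z \<le> 0}"
    by (auto simp: unit_seg_def)
  also have "convex \<dots>"
    by (intro convex_Int convex_halfspace_Im_le convex_halfspace_Im_ge
        convex_halfspace_Re_le convex_halfspace_Re_ge)
  finally show ?thesis .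
qed

lemma rooted_mult: "rooted p \<Longrightarrow> rooted q \<Longrightarrow> rooted (p * q)"
  by (auto simp: rooted_def real_poly_mult)

lemma rooted_pderiv: "rooted p \<Longrightarrow> degree p > 0 \<Longrightarrow> rooted (pderiv p)"
  using Gauss_Lucas [OF convex_unit_seg, of p]
  by (auto simp: rooted_def real_poly_pderiv pderiv_eq_0_iff)

lemma rooted_upper: "rooted p \<Longrightarrow> Im z \<noteq> 0 \<Longrightarrow> poly p z \<noteq> 0"
  by (auto simp: rooted_def unit_seg_def)

text \<open>The condition is real affine in \<open>z\<close>: a half plane, or everything if
  \<open>c = 0\<close>.\<close>

lemma convex_cross_right: "convex {z. 0 \<le> cross c (z + d)}"
  unfolding convex_def
proof (intro ballI allI impI, clarify)
  fix x y :: complex and u v :: real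
  assume *: "0 \<le> cross c (x + d)" "0 \<le> cross c (y + d)" "0 \<le> u" "0 \<le> v" "u + v = 1"
  then have "0 \<le> u * cross c (x + d) + v * cross c (y + d)"
    by simp
  also have "\<dots> = cross c (u *\<^sub>R x + v *\<^sub>R y + of_real (u + v) * d)"
    by (simp add: cross_def algebra_simps)
  finally show "0 \<le> cross c (u *\<^sub>R x + v *\<^sub>R y + d)"
    using * by simp
qed

lemma convex_cross_left: "convex {z. 0 \<le> cross (z + d) c}"
proof -
  have "cross (z + d) c = cross (- c) (z + d)" for z
    by (simp add: cross_def algebra_simps)
  then show ?thesis
    using convex_cross_right [of "- c" d] by simp
qed

text \<open>For \<open>Im c > 0\<close> this set is a closed disc whose boundary passes through -1 and 0.\<close>
lemma convex_disc:
  assumes "Im c \<ge> 0"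
  shows "convex {z. 0 \<le> cross ((z + 1) * c) z}"
  unfolding convex_def
proof (intro ballI allI impI, clarify)
  fix x y :: complex and u v :: real
  assume *: "0 \<le> cross ((x + 1) * c) x" "0 \<le> cross ((y + 1) * c) y" "0 \<le> u" "0 \<le> v" "u + v = 1"
  \<comment> \<open>An affine function minus \<open>Im c\<close> times the squared modulus, hence
    concave; \<open>sq\<close> is the convexity of the square.\<close>
  have eq: "cross ((z + 1) * c) z = Im z * Re c - Re z * Im c - Im c * ((Re z)\<^sup>2 + (Im z)\<^sup>2)" for z
    by (simp add: cross_def algebra_simps power2_eq_square)
  have sq: "(u * a + v * b)\<^sup>2 \<le> u * a\<^sup>2 + v * b\<^sup>2" for a b :: real
  proof -
    have "u * a\<^sup>2 + v * b\<^sup>2 - (u * a + v * b)\<^sup>2 = u * v * (a - b)\<^sup>2"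
      using \<open>u + v = 1\<close> by algebra
    moreover have "0 \<le> u * v * (a - b)\<^sup>2"
      using * by simp
    ultimately show ?thesis
      by linarith
  qed
  define X Y where "X = u * Re x + v * Re y" and "Y = u * Im x + v * Im y"
  have "Im c * (X\<^sup>2 + Y\<^sup>2) \<le> Im c * (u * (Re x)\<^sup>2 + v * (Re y)\<^sup>2 + (u * (Im x)\<^sup>2 + v * (Im y)\<^sup>2))"
    unfolding X_def Y_def using assms sq by (intro mult_left_mono add_mono) auto
  moreover have "0 \<le> u * cross ((x + 1) * c) x + v * cross ((y + 1) * c) y"
    using * by simp
  ultimately have "0 \<le> Y * Re c - X * Im c - Im c * (X\<^sup>2 + Y\<^sup>2)"
    unfolding eq by (simp add: X_def Y_def algebra_simps)
  then show "0 \<le> cross ((u *\<^sub>R x + v *\<^sub>R y + 1) * c) (u *\<^sub>R x + v *\<^sub>R y)"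
    unfolding eq by (simp add: X_def Y_def)
qed

section \<open>The factors x and w = x + 1, and derivatives of interlacing pairs\<close>

definition X :: "complex poly" where "X = [:0, 1:]"
definition W :: "complex poly" where "W = [:1, 1:]"

lemma poly_X [simp]: "poly X z = z" and poly_W [simp]: "poly W z = z + 1"
  by (auto simp: X_def W_def)

lemma degree_X [simp]: "degree X = 1" and degree_W [simp]: "degree W = 1"
  and lead_coeff_X [simp]: "coeff X (Suc 0) = 1" and lead_coeff_W [simp]: "coeff W (Suc 0) = 1"
  and X_neq_0 [simp]: "X \<noteq> 0" and W_neq_0 [simp]: "W \<noteq> 0"
  and pderiv_X [simp]: "pderiv X = 1" and pderiv_W [simp]: "pderiv W = 1"
  by (auto simp: X_def W_def pderiv_pCons)

lemma W_eq: "W = X + 1"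
  by (simp add: X_def W_def one_pCons)

lemma rooted_X [simp]: "rooted X" and rooted_W [simp]: "rooted W"
  by (auto simp: rooted_def unit_seg_def X_def W_def add_eq_0_iff)

lemma real_poly_X [simp]: "real_poly X" and real_poly_W [simp]: "real_poly W"
  by (auto simp: X_def W_def)

lemma lead_coeff_pderiv:
  "lead_coeff (pderiv p) = of_nat (degree p) * lead_coeff (p :: complex poly)"
  by (cases "degree p = 0") (auto simp: degree_pderiv coeff_pderiv pderiv_eq_0_iff coeff_eq_0)

text \<open>
  Where \<open>g = c * f\<close>, the hypotheses say \<open>arg (z + 1) \<le> arg c \<le> arg z\<close>. So the roots of \<open>g - c * f\<close>
  lie in a strip, which is convex.
\<close>
lemma cross_pderiv_quotient_strip:
  assumes f: "rooted f" and g: "real_poly g" and deg: "degree f < degree g"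
    and i1: "interl (W * f) g" and i2: "interl g (X * f)"
    and z: "Im z > 0" and gz: "poly (pderiv g) z = c * poly (pderiv f) z"
  shows "0 \<le> cross (z + 1) c \<and> 0 \<le> cross c z"
proof -
  define s where "s = g - smult c f"
  have deg_s: "degree s > 0"
    using deg degree_smult_le [of c f] degree_add_eq_left [of "- smult c f" g]
    by (auto simp: s_def)
  have ds: "poly (pderiv s) z = 0"
    by (simp add: s_def pderiv_diff pderiv_smult gz)
  have upper: "0 \<le> cross (\<zeta> + 1) d \<and> 0 \<le> cross d \<zeta>" if "Im \<zeta> > 0" "poly g \<zeta> = d * poly f \<zeta>" for \<zeta> d
  proof -
    have "poly f \<zeta> \<noteq> 0"
      using rooted_upper [OF f] that by auto
    moreover have "0 \<le> cross (\<zeta> + 1) d * (cmod (poly f \<zeta>))\<^sup>2"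
      "0 \<le> cross d \<zeta> * (cmod (poly f \<zeta>))\<^sup>2"
      using i1 i2 that by (auto simp: interl_def cross_mult dest!: spec [of _ \<zeta>])
    ultimately show ?thesis
      by (simp add: zero_le_mult_iff)
  qed
  \<comment> \<open>Since \<open>cross\<close> is antisymmetric, the two values in
    \<open>upper\<close> add up to \<open>Im d\<close>.\<close>
  have upper': "0 \<le> Im d" if "Im \<zeta> > 0" "poly g \<zeta> = d * poly f \<zeta>" for \<zeta> d
    using upper [OF that] by (simp add: cross_def algebra_simps)
  have s_root: "poly g \<zeta> = c * poly f \<zeta>" if "poly s \<zeta> = 0" for \<zeta>
    using that by (simp add: s_def)
  have "Im c \<ge> 0"
  proof (rule ccontr)
    assume c: "\<not> Im c \<ge> 0"
    have "z \<in> {z. Im z \<le> 0}"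
      using upper' s_root c by (intro Gauss_Lucas [OF convex_Im_le_0 _ deg_s ds]) force
    then show False
      using z by simp
  qed
  \<comment> \<open>For \<open>Im c > 0\<close> this is the closed strip between the lines through
    -1 and 0 in the direction \<open>c\<close>.\<close>
  define S where "S = {z. 0 \<le> cross (z + 1) c} \<inter> {z. 0 \<le> cross c (z + 0)}"
  have "z \<in> S"
  proof (rule Gauss_Lucas [OF _ _ deg_s ds])
    show "convex S"
      unfolding S_def by (intro convex_Int convex_cross_left convex_cross_right)
    fix \<zeta> assume "poly s \<zeta> = 0"
    note \<zeta> = s_root [OF this]
    consider "Im \<zeta> > 0" | "Im \<zeta> = 0" | "Im \<zeta> < 0"
      by linarith
    then show "\<zeta> \<in> S"
    proof cases
      case 1
      with upper \<zeta> show ?thesis by (auto simp: S_def)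
    next
      case 2
      \<comment> \<open>For real \<open>c\<close> every real point belongs to \<open>S\<close>;
        otherwise a real root of \<open>s\<close> is a root of \<open>f\<close> and lies in the
        segment.\<close>
      then have "Im (poly f \<zeta>) = 0" "Im (poly g \<zeta>) = 0"
        using f g by (auto simp: rooted_def real_poly_Im)
      then have "Im c = 0 \<or> poly f \<zeta> = 0"
        using \<zeta> by (auto simp: complex_eq_iff)
      then have "Im c = 0 \<or> - 1 \<le> Re \<zeta> \<and> Re \<zeta> \<le> 0"
        using f by (auto simp: rooted_def unit_seg_def)
      then show ?thesis
        using 2 \<open>Im c \<ge> 0\<close> by (auto simp: S_def cross_def mult_nonpos_nonneg)
    next
      case 3
      \<comment> \<open>The conjugate point lies in the upper half plane, and its inequalities force
        \<open>c = 0\<close>, where \<open>S\<close> is the whole plane.\<close>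
      have "poly g (cnj \<zeta>) = cnj c * poly f (cnj \<zeta>)"
        using \<zeta> f g by (simp add: real_poly_cnj rooted_def)
      with 3 upper [of "cnj \<zeta>" "cnj c"] upper' [of "cnj \<zeta>" "cnj c"] \<open>Im c \<ge> 0\<close>
      have "Im c = 0" "0 \<le> cross (cnj \<zeta> + 1) (cnj c)" "0 \<le> cross (cnj c) (cnj \<zeta>)"
        by auto
      then have "Im c = 0" "Re c = 0"
        using 3 by (auto simp: cross_def mult_le_0_iff zero_le_mult_iff)
      then show ?thesis
        by (simp add: S_def cross_def)
    qed
  qed
  then show ?thesis
    by (simp add: S_def)
qed

lemma interl_pderiv_strip:
  assumes f: "rooted f" "degree f > 0" and g: "real_poly g" and deg: "degree f < degree g"
    and i: "interl (W * f) g" "interl g (X * f)"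
  shows "interl (W * pderiv f) (pderiv g)" and "interl (pderiv g) (X * pderiv f)"
proof -
  have "0 \<le> cross (poly (W * pderiv f) z) (poly (pderiv g) z) \<and>
      0 \<le> cross (poly (pderiv g) z) (poly (X * pderiv f) z)" if z: "Im z > 0" for z
  proof -
    define c where "c = poly (pderiv g) z / poly (pderiv f) z"
    have "poly (pderiv f) z \<noteq> 0"
      using rooted_upper [OF rooted_pderiv [OF f]] z by auto
    then have gz: "poly (pderiv g) z = c * poly (pderiv f) z"
      by (simp add: c_def)
    show ?thesis
      using cross_pderiv_quotient_strip [OF f(1) g deg i z gz]
      by (simp add: gz cross_mult)
  qed
  then show "interl (W * pderiv f) (pderiv g)" "interl (pderiv g) (X * pderiv f)"
    by (auto simp: interl_def)
qed

text \<open>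
  The same argument with a disc in place of the strip: now \<open>q = c * p\<close> forces
  \<open>0 \<le> arg c \<le> arg (z / (z + 1))\<close>.
\<close>
lemma interl_pderiv_disc:
  assumes p: "rooted p" "degree p > 0" and q: "real_poly q" and deg: "degree p = degree q"
    and lead: "lead_coeff p = of_real r * lead_coeff q" and r: "r > 0"
    and i1: "interl p q" and i2: "interl (W * q) (X * p)"
  shows "interl (W * pderiv q) (X * pderiv p)"
  unfolding interl_def
proof (intro allI impI)
  fix z :: complex assume z: "Im z > 0"
  define c where "c = poly (pderiv q) z / poly (pderiv p) z"
  have "poly (pderiv p) z \<noteq> 0"
    using rooted_upper [OF rooted_pderiv [OF p]] z by auto
  then have qz: "poly (pderiv q) z = c * poly (pderiv p) z"
    by (simp add: c_def)
  define s where "s = q - smult c p"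
  \<comment> \<open>The top coefficient of \<open>s\<close> vanishes only for
    \<open>c = 1 / r\<close>. This is a positive real, where the final inequality holds without
    Gauss-Lucas.\<close>
  have deg_s: "degree s > 0" if "\<not> (Im c = 0 \<and> Re c \<ge> 0)"
  proof -
    have "c * of_real r \<noteq> 1"
    proof
      assume "c * of_real r = 1"
      then have "Re c * r = 1" "Im c * r = 0"
        by (simp_all add: complex_eq_iff)
      then have "Im c = 0" "Re c = 1 / r"
        using r by (auto simp: field_simps)
      with that r show False
        by simp
    qed
    moreover have "coeff s (degree q) = lead_coeff q * (1 - c * of_real r)"
      using lead deg by (simp add: s_def algebra_simps)
    moreover have "q \<noteq> 0"
      using deg p(2) by auto
    ultimately have "coeff s (degree q) \<noteq> 0"
      by simp
    then have "degree q \<le> degree s"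
      by (rule le_degree)
    then show ?thesis
      using deg p by simp
  qed
  have ds: "poly (pderiv s) z = 0"
    by (simp add: s_def pderiv_diff pderiv_smult qz)
  have upper: "0 \<le> Im d \<and> 0 \<le> cross ((\<zeta> + 1) * d) \<zeta>"
    if "Im \<zeta> > 0" "poly q \<zeta> = d * poly p \<zeta>" for \<zeta> d
  proof -
    have "poly p \<zeta> \<noteq> 0"
      using rooted_upper [OF p(1)] that by auto
    moreover have "0 \<le> Im d * (cmod (poly p \<zeta>))\<^sup>2"
      "0 \<le> cross ((\<zeta> + 1) * d) \<zeta> * (cmod (poly p \<zeta>))\<^sup>2"
      using i1 i2 that
      by (auto simp: interl_def cross_mult cross_mult_self mult.assoc [symmetric] dest!: spec [of _ \<zeta>])
    ultimately show ?thesis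
      by (simp add: zero_le_mult_iff)
  qed
  have s_root: "poly q \<zeta> = c * poly p \<zeta>" if "poly s \<zeta> = 0" for \<zeta>
    using that by (simp add: s_def)
  have real_cross: "cross ((\<zeta> + 1) * c) \<zeta> = Re c * Im \<zeta>" if "Im c = 0" for \<zeta>
    using that by (simp add: cross_def algebra_simps)
  have "0 \<le> cross ((z + 1) * c) z"
  proof -
    consider "Im c < 0" | "Im c = 0" "Re c < 0" | "Im c = 0" "Re c \<ge> 0" | "Im c > 0"
      by linarith
    then show ?thesis
    proof cases
      case 1
      have "z \<in> {z. Im z \<le> 0}"
        using upper s_root 1 deg_s by (intro Gauss_Lucas [OF convex_Im_le_0 _ _ ds]) force+
      then show ?thesis
        using z by simp
    next
      case 2
      have "Im \<zeta> \<le> 0" if "poly s \<zeta> = 0" for \<zeta>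
        using upper [of \<zeta> c] s_root [OF that] 2 real_cross [of \<zeta>]
        by (cases "Im \<zeta> > 0") (auto simp: zero_le_mult_iff)
      then have "z \<in> {z. Im z \<le> 0}"
        using 2 deg_s by (intro Gauss_Lucas [OF convex_Im_le_0 _ _ ds]) auto
      then show ?thesis
        using z by simp
    next
      case 3
      then show ?thesis
        using z real_cross by simp
    next
      case 4
      have "z \<in> {z. 0 \<le> cross ((z + 1) * c) z}"
      proof (rule Gauss_Lucas [OF _ _ _ ds])
        show "convex {z. 0 \<le> cross ((z + 1) * c) z}"
          using 4 by (intro convex_disc) auto
        show "degree s > 0"
          using deg_s 4 by simp
        fix \<zeta> assume "poly s \<zeta> = 0"
        note \<zeta> = s_root [OF this]
        consider "Im \<zeta> > 0" | "Im \<zeta> = 0" | "Im \<zeta> < 0"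
          by linarith
        then show "\<zeta> \<in> {z. 0 \<le> cross ((z + 1) * c) z}"
        proof cases
          case 1
          with upper \<zeta> show ?thesis by auto
        next
          case 2
          then have "Im (poly p \<zeta>) = 0" "Im (poly q \<zeta>) = 0"
            using p q by (auto simp: rooted_def real_poly_Im)
          then have "poly p \<zeta> = 0"
            using \<zeta> 4 by (auto simp: complex_eq_iff)
          then have "- 1 \<le> Re \<zeta>" "Re \<zeta> \<le> 0"
            using p by (auto simp: rooted_def unit_seg_def)
          moreover have "cross ((\<zeta> + 1) * c) \<zeta> = - Re \<zeta> * (Re \<zeta> + 1) * Im c"
            using 2 by (simp add: cross_def algebra_simps)
          ultimately show ?thesis
            using 4 by (auto intro!: mult_nonneg_nonneg simp: mult_le_0_iff)
        next
          case 3
          have "poly q (cnj \<zeta>) = cnj c * poly p (cnj \<zeta>)"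
            using \<zeta> p q by (simp add: real_poly_cnj rooted_def)
          then show ?thesis
            using 3 4 upper [of "cnj \<zeta>" "cnj c"] by auto
        qed
      qed
      then show ?thesis
        by simp
    qed
  qed
  then show "0 \<le> cross (poly (W * pderiv q) z) (poly (X * pderiv p) z)"
    by (simp add: qz cross_mult mult.assoc [symmetric])
qed

section \<open>The operators of the recurrence\<close>

definition bop :: "complex poly \<Rightarrow> complex poly" where
  "bop f = W\<^sup>2 * pderiv (X * f)"

definition nuop :: "complex poly \<Rightarrow> complex poly" where
  "nuop f = X * W * pderiv f"

lemma real_poly_bop: "real_poly f \<Longrightarrow> real_poly (bop f)"
  and real_poly_nuop: "real_poly f \<Longrightarrow> real_poly (nuop f)"
  unfolding bop_def nuop_def
  by (intro real_poly_mult real_poly_power real_poly_pderiv real_poly_X real_poly_W; assumption)+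

lemma bop_0 [simp]: "bop 0 = 0" and nuop_0 [simp]: "nuop 0 = 0"
  by (auto simp: bop_def nuop_def)

lemma bop_add: "bop (f + g) = bop f + bop g"
  and nuop_add: "nuop (f + g) = nuop f + nuop g"
  by (auto simp: bop_def nuop_def algebra_simps pderiv_add)

lemma bop_pow_0 [simp]: "(bop ^^ j) 0 = 0"
  by (induction j) auto

lemma bop_pow_add: "(bop ^^ j) (f + g) = (bop ^^ j) f + (bop ^^ j) g"
  by (induction j) (auto simp: bop_add)

lemma pderiv_W_power2: "pderiv (W\<^sup>2) = 2 * W"
  by (simp add: power2_eq_square pderiv_mult)

text \<open>The commutation rule that moves \<open>nuop\<close> inside \<open>bop\<close>, so that
  \<open>interl_bop\<close> can be applied to both sides of a relation.\<close>

lemma nuop_bop: "nuop (bop f) = bop (nuop f + X * f)"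
  by (simp add: nuop_def bop_def pderiv_mult pderiv_add pderiv_W_power2 W_eq algebra_simps power2_eq_square)

lemma degree_bop: "f \<noteq> 0 \<Longrightarrow> degree (bop f) = degree f + 2"
proof -
  assume "f \<noteq> 0"
  then have "degree (pderiv (X * f)) = degree f"
    by (simp add: degree_pderiv degree_mult_eq)
  moreover have "pderiv (X * f) \<noteq> 0"
    using \<open>f \<noteq> 0\<close> by (simp add: pderiv_eq_0_iff degree_mult_eq)
  ultimately show ?thesis
    by (simp add: bop_def degree_mult_eq power2_eq_square)
qed

lemma lead_coeff_bop: "lead_coeff (bop f) = of_nat (degree f + 1) * lead_coeff f"
proof (cases "f = 0")
  case False
  have "lead_coeff (bop f) = lead_coeff (pderiv (X * f))"
    by (simp only: bop_def lead_coeff_mult lead_coeff_power) simp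
  also have "\<dots> = of_nat (degree (X * f)) * lead_coeff (X * f)"
    by (rule lead_coeff_pderiv)
  also have "lead_coeff (X * f) = lead_coeff f"
    by (simp only: lead_coeff_mult) simp
  finally show ?thesis
    using False by (simp add: degree_mult_eq)
qed simp

lemma degree_nuop: "degree f > 0 \<Longrightarrow> degree (nuop f) = degree f + 1"
  by (subgoal_tac "pderiv f \<noteq> 0")
    (auto simp: nuop_def degree_mult_eq degree_pderiv pderiv_eq_0_iff)

lemma lead_coeff_nuop: "lead_coeff (nuop f) = of_nat (degree f) * lead_coeff f"
  by (simp add: nuop_def lead_coeff_mult lead_coeff_pderiv)

lemma rooted_bop: "rooted f \<Longrightarrow> rooted (bop f)"
  unfolding bop_def power2_eq_square
  by (intro rooted_mult rooted_pderiv rooted_X rooted_W)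
    (auto simp: degree_mult_eq rooted_def)

lemma rooted_bop_pow: "rooted f \<Longrightarrow> rooted ((bop ^^ j) f)"
  by (induction j) (auto intro: rooted_bop)

lemma rooted_nuop: "rooted f \<Longrightarrow> degree f > 0 \<Longrightarrow> rooted (nuop f)"
  unfolding nuop_def by (intro rooted_mult rooted_pderiv rooted_X rooted_W)

lemma interl_bop:
  assumes "interl f g" "rooted f" "real_poly g"
  shows "interl (bop f) (bop g)"
proof -
  have "interl (pderiv (X * f)) (pderiv (X * g))"
    using assms interl_mult [OF assms(1), of X] rooted_mult [OF rooted_X assms(2)]
    by (intro interl_pderiv) (auto simp: mult.commute real_poly_mult rooted_def unit_seg_def X_def)
  then show ?thesis
    using interl_mult [of _ _ "W\<^sup>2"] by (simp add: bop_def mult.commute)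
qed

text \<open>The two interlacings say that arg (g / f) lies between arg (z + 1) and arg z on the
  upper half plane. The conditions on degrees and leading coefficients keep the polynomials
  \<open>s\<close> in the strip and disc arguments nonconstant.\<close>

definition strip_pair :: "complex poly \<Rightarrow> complex poly \<Rightarrow> bool" where
  "strip_pair f g \<longleftrightarrow> rooted f \<and> rooted g \<and> degree g = degree f + 1 \<and>
     (\<exists>r>0. lead_coeff g = of_real r * lead_coeff f) \<and>
     interl (W * f) g \<and> interl g (X * f)"

text \<open>By partial fractions it suffices to look at single roots: for \<open>r i\<close> in the
  segment, \<open>z / (z - r i)\<close> has imaginary part \<ge> 0 and
  \<open>(z + 1) / (z - r i)\<close> has imaginary part \<le> 0.\<close>

lemma strip_pair_nuop:
  assumes f: "rooted f" and deg: "degree f > 0"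
  shows "strip_pair f (nuop f)"
proof -
  obtain r where r: "\<And>i. i < degree f \<Longrightarrow> poly f (r i) = 0"
    and s: "\<And>w. poly f w \<noteq> 0 \<Longrightarrow> poly (pderiv f) w = poly f w * (\<Sum>i<degree f. 1 / (w - r i))"
    using log_pderiv_complex [of f] by metis
  have seg: "Im (r i) = 0" "- 1 \<le> Re (r i)" "Re (r i) \<le> 0" if "i < degree f" for i
    using r [OF that] f by (auto simp: rooted_def unit_seg_def)
  have "0 \<le> Im (z * (\<Sum>i<degree f. 1 / (z - r i))) \<and> 0 \<le> cross ((z + 1) * (\<Sum>i<degree f. 1 / (z - r i))) 1"
    if z: "Im z > 0" for z
  proof -
    have *: "0 \<le> Im (z * (1 / (z - r i))) \<and> Im ((z + 1) * (1 / (z - r i))) \<le> 0" if "i < degree f" for i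
    proof -
      have eq: "Im ((z + of_real t) * (1 / (z - r i))) = - (t + Re (r i)) * Im z / (cmod (z - r i))\<^sup>2" for t
        using seg [OF that] by (simp add: Im_divide cmod_power2 field_simps)
      show ?thesis
        using eq [of 0] eq [of 1] seg [OF that] z
        by (auto intro!: divide_nonneg_nonneg divide_nonpos_nonneg mult_nonneg_nonneg mult_nonpos_nonneg
            simp: add_nonneg_nonneg)
    qed
    have "0 \<le> (\<Sum>i<degree f. Im (z * (1 / (z - r i))))"
      "(\<Sum>i<degree f. Im ((z + 1) * (1 / (z - r i)))) \<le> 0"
      using * by (auto intro!: sum_nonneg sum_nonpos)
    then have "0 \<le> Im (z * (\<Sum>i<degree f. 1 / (z - r i)))"
      "Im ((z + 1) * (\<Sum>i<degree f. 1 / (z - r i))) \<le> 0"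
      by (simp_all only: sum_distrib_left Im_sum)
    then show ?thesis
      by simp
  qed
  note * = this
  have "0 \<le> cross (poly f z) (poly (X * pderiv f) z) \<and> 0 \<le> cross (poly (W * pderiv f) z) (poly f z)"
    if z: "Im z > 0" for z
  proof -
    let ?S = "\<Sum>i<degree f. 1 / (z - r i)"
    have "poly (pderiv f) z = ?S * poly f z"
      using s [of z] rooted_upper [OF f] z by (simp add: mult.commute)
    then have "cross (poly f z) (poly (X * pderiv f) z) = Im (z * ?S) * (cmod (poly f z))\<^sup>2"
      "cross (poly (W * pderiv f) z) (poly f z) = cross ((z + 1) * ?S) 1 * (cmod (poly f z))\<^sup>2"
      using cross_mult_self [of "poly f z" "z * ?S"] cross_mult [of "(z + 1) * ?S" "poly f z" 1]
      by (simp_all only: poly_mult poly_X poly_W mult.assoc mult_1)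
    then show ?thesis
      using * [OF z] by simp
  qed
  then have "interl f (X * pderiv f)" "interl (W * pderiv f) f"
    by (auto simp: interl_def)
  then have "interl (W * f) (nuop f)" "interl (nuop f) (X * f)"
    using interl_mult [of f "X * pderiv f" W] interl_mult [of "W * pderiv f" f X]
    by (simp_all add: nuop_def ac_simps)
  moreover have "lead_coeff (nuop f) = of_real (real (degree f)) * lead_coeff f"
    by (simp add: lead_coeff_nuop)
  ultimately show ?thesis
    using assms degree_nuop rooted_nuop unfolding strip_pair_def
    by (metis of_nat_0_less_iff)
qed

text \<open>Multiplication by a common factor preserves the strip condition, and
  \<open>interl_pderiv_strip\<close> carries it from \<open>X * f\<close> and \<open>X * g\<close>
  to their derivatives.\<close>

lemma strip_pair_bop:
  assumes "strip_pair f g"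
  shows "strip_pair (bop f) (bop g)"
proof -
  obtain r where f: "rooted f" and g: "rooted g" and deg: "degree g = degree f + 1"
    and r: "r > 0" "lead_coeff g = of_real r * lead_coeff f"
    and i: "interl (W * f) g" "interl g (X * f)"
    using assms by (auto simp: strip_pair_def)
  have nz: "f \<noteq> 0" "g \<noteq> 0"
    using f g by (auto simp: rooted_def)
  have fx: "rooted (X * f)" "degree (X * f) > 0" and gx: "real_poly (X * g)" "degree (X * f) < degree (X * g)"
    using f g deg nz rooted_mult [OF rooted_X] by (auto simp: degree_mult_eq rooted_def)
  have "interl (W * (X * f)) (X * g)" "interl (X * g) (X * (X * f))"
    using i [THEN interl_mult, of X] by (simp_all add: ac_simps)
  note * = interl_pderiv_strip [OF fx gx this]
  have "interl (W * bop f) (bop g)" "interl (bop g) (X * bop f)"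
    using * [THEN interl_mult, of "W\<^sup>2"] by (simp_all add: bop_def ac_simps)
  moreover have "lead_coeff (bop g) = of_real (r * (degree f + 2) / (degree f + 1)) * lead_coeff (bop f)"
    using r deg by (simp add: lead_coeff_bop field_simps of_nat_Suc [symmetric] del: of_nat_Suc)
  moreover have "r * (degree f + 2) / (degree f + 1) > 0"
    using r by simp
  ultimately show ?thesis
    using f g deg nz by (auto simp: strip_pair_def rooted_bop degree_bop)
qed

text \<open>The disc argument with \<open>p = g\<close> and \<open>q = X * f\<close>, which have
  equal degree.\<close>

lemma strip_pair_bop_nuop:
  assumes "strip_pair f g"
  shows "interl (bop f) (nuop g)"
proof -
  obtain r where f: "rooted f" and g: "rooted g" and deg: "degree g = degree f + 1"
    and r: "r > 0" "lead_coeff g = of_real r * lead_coeff f"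
    and i: "interl (W * f) g" "interl g (X * f)"
    using assms by (auto simp: strip_pair_def)
  have "interl (W * pderiv (X * f)) (X * pderiv g)"
  proof (rule interl_pderiv_disc [OF g])
    show "interl (W * (X * f)) (X * g)"
      using interl_mult [OF i(1), of X] by (simp add: ac_simps)
  qed (use deg r i f in \<open>auto simp: degree_mult_eq rooted_def real_poly_mult lead_coeff_mult X_def\<close>)
  from interl_mult [OF this, of W] show ?thesis
    by (simp add: bop_def nuop_def ac_simps power2_eq_square)
qed

lemma strip_pair_bop_pow_nuop:
  assumes "rooted f" "degree f > 0"
  shows "strip_pair ((bop ^^ j) f) ((bop ^^ j) (nuop f))"
  by (induction j) (auto intro: strip_pair_bop strip_pair_nuop assms)

text \<open>One \<open>bop\<close> short of \<open>interl_bop_pow_bop\<close>: by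
  \<open>nuop_bop\<close>, applying \<open>bop\<close> to the right side gives
  \<open>nuop ((bop ^^ Suc j) f)\<close>. In the induction the summand with factor \<open>X\<close>
  is supplied anew by the strip pair.\<close>

lemma interl_bop_pow_nuop_add:
  assumes f: "rooted f" "degree f > 0"
  shows "interl ((bop ^^ j) (nuop f)) (nuop ((bop ^^ j) f) + X * (bop ^^ j) f)"
proof (induction j)
  case 0
  then show ?case
    using strip_pair_nuop [OF f] by (auto simp: strip_pair_def interl_refl intro: interl_add_right)
next
  case (Suc j)
  let ?h = "(bop ^^ j) f"
  have "real_poly (nuop ?h + X * ?h)"
    using rooted_bop_pow [OF f(1), of j]
    by (auto simp: rooted_def intro!: real_poly_add real_poly_mult real_poly_nuop)
  then have "interl ((bop ^^ Suc j) (nuop f)) (bop (nuop ?h + X * ?h))"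
    using interl_bop [OF Suc.IH] rooted_bop_pow [OF rooted_nuop [OF f]] by simp
  moreover have "interl ((bop ^^ Suc j) (nuop f)) (X * (bop ^^ Suc j) f)"
    using strip_pair_bop_pow_nuop [OF f, of "Suc j"] by (simp only: strip_pair_def)
  ultimately show ?case
    by (simp add: nuop_bop interl_add_right)
qed

lemma interl_bop_pow_nuop:
  assumes "rooted f" "degree f > 0"
  shows "interl ((bop ^^ Suc j) f) (nuop ((bop ^^ j) (nuop f)))"
  using strip_pair_bop_nuop [OF strip_pair_bop_pow_nuop [OF assms]] by simp

lemma interl_bop_pow_bop:
  assumes f: "rooted f" "degree f > 0"
  shows "interl ((bop ^^ Suc j) (nuop f)) (nuop ((bop ^^ j) (bop f)))"
proof -
  let ?h = "(bop ^^ j) f"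
  have "real_poly (nuop ?h + X * ?h)"
    using rooted_bop_pow [OF f(1), of j]
    by (auto simp: rooted_def intro!: real_poly_add real_poly_mult real_poly_nuop)
  then have "interl (bop ((bop ^^ j) (nuop f))) (bop (nuop ?h + X * ?h))"
    using interl_bop [OF interl_bop_pow_nuop_add [OF f]] rooted_bop_pow [OF rooted_nuop [OF f]] by simp
  moreover have "(bop ^^ j) (bop f) = bop ?h"
    by (simp add: funpow_swap1)
  ultimately show ?thesis
    by (simp add: nuop_bop)
qed

text \<open>
  At a root of \<open>p + q\<close> the quotient \<open>q / p\<close> takes the boundary value \<open>- 1\<close> of the closed upper half
  plane, so by the open mapping theorem it is constant.
\<close>
lemma interl_add_neq_0:
  assumes i: "interl p q" and p: "\<And>z. Im z > 0 \<Longrightarrow> poly p z \<noteq> 0"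
    and nz: "p + q \<noteq> 0" and z: "Im z > 0"
  shows "poly (p + q) z \<noteq> 0"
proof
  assume root: "poly (p + q) z = 0"
  define f where "f \<zeta> = poly q \<zeta> / poly p \<zeta>" for \<zeta>
  let ?H = "{\<zeta>. Im \<zeta> > 0}"
  have q: "poly q \<zeta> = f \<zeta> * poly p \<zeta>" if "Im \<zeta> > 0" for \<zeta>
    using p [OF that] by (simp add: f_def)
  have H: "open ?H" "connected ?H"
    by (auto simp: open_halfspace_Im_gt convex_halfspace_Im_gt intro: convex_connected)
  have "f holomorphic_on ?H"
    unfolding f_def using p by (intro holomorphic_intros) auto
  have fz: "f z = - 1"
    using root p [OF z] by (simp add: f_def field_simps add_eq_0_iff)
  have "\<not> f constant_on ?H"
  proof
    assume "f constant_on ?H"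
    then have "poly (p + q) \<zeta> = 0" if "Im \<zeta> > 0" for \<zeta>
      using q [OF that] fz z that by (auto simp: constant_on_def)
    then have "?H \<subseteq> {\<zeta>. poly (p + q) \<zeta> = 0}"
      by auto
    then have "finite ?H"
      using poly_roots_finite [OF nz] finite_subset by blast
    then show False
      using z H(1) finite_imp_not_open by blast
  qed
  then have "open (f ` ?H)"
    using open_mapping_thm [OF \<open>f holomorphic_on ?H\<close> H H(1)] by simp
  then obtain e where e: "e > 0" "ball (- 1) e \<subseteq> f ` ?H"
    using fz z by (metis (mono_tags, lifting) image_eqI mem_Collect_eq openE)
  \<comment> \<open>A value of \<open>f\<close> just below -1 has negative imaginary part, contrary
    to \<open>interl p q\<close>.\<close>
  have "- 1 - Complex (- 1) (- e / 2) = Complex 0 (e / 2)"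
    by (simp add: complex_eq_iff)
  then have "Complex (- 1) (- e / 2) \<in> ball (- 1) e"
    using e(1) by (simp add: dist_norm complex_norm)
  then obtain \<zeta> where \<zeta>: "Im \<zeta> > 0" "f \<zeta> = Complex (- 1) (- e / 2)"
    using e(2) by auto
  then have "0 \<le> - e / 2 * (cmod (poly p \<zeta>))\<^sup>2"
    using i q [of \<zeta>] by (auto simp: interl_def cross_mult_self dest!: spec [of _ \<zeta>])
  then show False
    using e(1) p [of \<zeta>] \<zeta>(1) by (simp add: mult_le_0_iff)
qed

text \<open>Interlacing excludes only non-real zeros; \<open>bound\<close> places the real ones and,
  at \<open>x = 1\<close>, shows \<open>G n\<close> to be nonzero.\<close>

lemma rooted_bop_nuop_recurrence:
  fixes G :: "nat \<Rightarrow> complex poly"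
  assumes G0: "G 0 = 0" and G1: "G 1 = W\<^sup>2"
    and rec: "\<And>n. G (n + 2) = nuop (G (n + 1)) + bop (G n)"
    and bound: "\<And>n x. n \<ge> 1 \<Longrightarrow> poly (G n) (of_real x) = 0 \<Longrightarrow> - 1 \<le> x \<and> x \<le> 0"
    and "n \<ge> 1"
  shows "rooted (G n)"
proof -
  have nz: "G n \<noteq> 0" if "n \<ge> 1" for n
    using bound [OF that, of 1] by auto
  have deg: "degree (G n) > 0" if "n \<ge> 1" for n
  proof -
    \<comment> \<open>Every \<open>G n\<close> with \<open>n \<ge> 1\<close> has the factor
      \<open>W\<close>, so -1 is a root.\<close>
    have "n = 1 \<or> (\<exists>m. n = m + 2)"
      using that by presburger
    then have "poly (G n) (- 1) = 0"
      by (auto simp: G1 [simplified] rec [simplified] nuop_def bop_def)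
    then show ?thesis
      using nz [OF that] by (cases "degree (G n) = 0") (auto elim!: degree_eq_zeroE)
  qed
  have real: "real_poly (G n) \<and> real_poly (G (Suc n))" for n
    by (induction n)
      (auto simp: G0 G1 [simplified] rec [simplified]
        intro!: real_poly_add real_poly_power real_poly_bop real_poly_nuop)
  have rootedI: "rooted (G n)" if "n \<ge> 1" "\<And>z. Im z > 0 \<Longrightarrow> poly (G n) z \<noteq> 0" for n
  proof -
    have "z \<in> unit_seg" if z: "poly (G n) z = 0" for z
    proof -
      have "poly (G n) (cnj z) = 0"
        using real z by (simp add: real_poly_cnj)
      then have "Im z = 0"
        using \<open>\<And>z. Im z > 0 \<Longrightarrow> poly (G n) z \<noteq> 0\<close> [of z]
          \<open>\<And>z. Im z > 0 \<Longrightarrow> poly (G n) z \<noteq> 0\<close> [of "cnj z"] z by force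
      then have "z = of_real (Re z)"
        by (simp add: complex_eq_iff)
      then show ?thesis
        using bound [OF \<open>n \<ge> 1\<close>, of "Re z"] z \<open>Im z = 0\<close> by (simp add: unit_seg_def)
    qed
    then show ?thesis
      using real nz [OF \<open>n \<ge> 1\<close>] by (simp add: rooted_def)
  qed
  have "rooted (G (n + 1)) \<and> (\<forall>j. interl ((bop ^^ Suc j) (G n)) (nuop ((bop ^^ j) (G (n + 1)))))" for n
  proof (induction n rule: less_induct)
    case (less n)
    consider "n = 0" | m where "n = m + 1"
      by (cases n) auto
    then show ?case
    proof cases
      case 1
      then show ?thesis
        by (simp add: G0 G1 [simplified] power2_eq_square rooted_mult del: funpow.simps)
    next
      case 2
      have IH: "rooted (G n)" "interl (bop (G m)) (nuop (G n))"
        using less.IH [of m] 2 by (auto dest: spec [of _ 0])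
      have Gn: "G (n + 1) = nuop (G n) + bop (G m)"
        using rec [of m] 2 by simp
      have degn: "degree (G n) > 0"
        using deg 2 by simp
      \<comment> \<open>The case \<open>m = 0\<close> is separate because \<open>G 0 = 0\<close> is
        not \<open>rooted\<close>.\<close>
      have "rooted (G (n + 1))"
      proof (cases "m = 0")
        case True
        then show ?thesis
          using rooted_nuop [OF IH(1) degn] by (simp add: Gn [simplified] G0)
      next
        case False
        then have "rooted (G m)"
          using less.IH [of "m - 1"] 2 by auto
        then have "poly (bop (G m) + nuop (G n)) z \<noteq> 0" if "Im z > 0" for z
          using IH(2) rooted_upper [OF rooted_bop] nz [of "n + 1"] that
          by (intro interl_add_neq_0) (auto simp: Gn [simplified] add.commute)
        then show ?thesis
          by (intro rootedI) (auto simp: Gn [simplified] add.commute)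
      qed
      moreover have "interl ((bop ^^ Suc j) (G n)) (nuop ((bop ^^ j) (bop (G m))))" for j
      proof (cases "m = 0")
        case True
        then show ?thesis
          by (simp add: G0)
      next
        case False
        then obtain k where k: "m = k + 1"
          by (cases m) auto
        have Gn': "G n = nuop (G m) + bop (G k)"
          using rec [of k] 2 k by simp
        have "rooted (G m)" "\<forall>j. interl ((bop ^^ Suc j) (G k)) (nuop ((bop ^^ j) (G m)))"
          using less.IH [of k] k 2 by auto
        \<comment> \<open>The first relation is \<open>interl_bop_pow_bop\<close>; the second is the
          induction hypothesis at \<open>Suc j\<close>, with one \<open>bop\<close> split off on
          each side.\<close>
        then have "interl ((bop ^^ Suc j) (nuop (G m))) (nuop ((bop ^^ j) (bop (G m))))"
          and "interl ((bop ^^ Suc j) (bop (G k))) (nuop ((bop ^^ j) (bop (G m))))"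
          using interl_bop_pow_bop [of "G m" j] deg [of m] False by (auto simp: funpow_swap1 dest: spec [of _ "Suc j"])
        then show ?thesis
          by (simp only: Gn' bop_pow_add interl_add_left)
      qed
      moreover have "interl ((bop ^^ Suc j) (G n)) (nuop ((bop ^^ j) (nuop (G n))))" for j
        by (rule interl_bop_pow_nuop [OF IH(1) degn])
      ultimately show ?thesis
        by (simp only: Gn bop_pow_add nuop_add interl_add_right simp_thms)
    qed
  qed
  from this [of "n - 1"] show ?thesis
    using \<open>n \<ge> 1\<close> by simp
qed

section \<open>Words and fixed points\<close>

definition num_greater :: "nat \<Rightarrow> nat list \<Rightarrow> nat" where
  "num_greater a xs = length (filter (\<lambda>c. a < c) xs)"

definition num_less :: "nat \<Rightarrow> nat list \<Rightarrow> nat" where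
  "num_less a xs = length (filter (\<lambda>c. c < a) xs)"

text \<open>
  The occurrence of \<open>a\<close> after the prefix \<open>ys\<close> is a fixed point of the standardization (stable sorting
  permutation) of the word; see \<open>std_split\<close> below.
\<close>
definition has_fix :: "nat \<Rightarrow> nat list \<Rightarrow> bool" where
  "has_fix a xs \<longleftrightarrow> (\<exists>ys zs. xs = ys @ a # zs \<and> num_greater a ys = num_less a zs)"

lemma num_simps [simp]:
  "num_greater a [] = 0" "num_less a [] = 0"
  "num_greater a (c # xs) = (if a < c then 1 else 0) + num_greater a xs"
  "num_less a (c # xs) = (if c < a then 1 else 0) + num_less a xs"
  "num_greater a (xs @ ys) = num_greater a xs + num_greater a ys"
  "num_less a (xs @ ys) = num_less a xs + num_less a ys"
  by (auto simp: num_greater_def num_less_def)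

lemma num_greater_mono: "a \<le> b \<Longrightarrow> num_greater b xs \<le> num_greater a xs"
  by (induction xs) auto

lemma num_less_mono: "a \<le> b \<Longrightarrow> num_less a xs \<le> num_less b xs"
  by (induction xs) auto

lemma num_greater_less_eq_0:
  "num_greater a xs = 0 \<Longrightarrow> num_less a xs = 0 \<Longrightarrow> xs = replicate (length xs) a"
  by (induction xs) (auto split: if_splits)

text \<open>Moving the cut past one letter raises \<open>num_greater a ys - num_less a zs\<close> by
  at most one, from a value \<le> 0 to a value \<ge> 0. In the induction \<open>k\<close> counts the
  larger letters already passed.\<close>

lemma balanced_split_exists:
  "\<exists>ys zs. xs = ys @ zs \<and> num_greater a ys = num_less a zs"
proof -
  have "\<exists>ys zs. xs = ys @ zs \<and> k + num_greater a ys = num_less a zs" if "k \<le> num_less a xs" for k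
    using that
  proof (induction xs arbitrary: k)
    case (Cons c xs)
    show ?case
    proof (cases "k = num_less a (c # xs)")
      case True
      then show ?thesis
        by (intro exI [of _ "[]"] exI [of _ "c # xs"]) auto
    next
      case False
      define k' where "k' = (if a < c then k + 1 else k)"
      have "k' \<le> num_less a xs"
        using Cons.prems False by (auto simp: k'_def split: if_splits)
      then obtain ys zs where "xs = ys @ zs" "k' + num_greater a ys = num_less a zs"
        using Cons.IH by blast
      then show ?thesis
        by (intro exI [of _ "c # ys"] exI [of _ zs]) (auto simp: k'_def split: if_splits)
    qed
  qed auto
  from this [of 0] show ?thesis
    by simp
qed

lemma replicate_append_Cons_same: "replicate k a @ a # xs = a # replicate k a @ xs"
  by (induction k) auto

text \<open>Comparing the two balances shows that the stretch between the cuts contains only copies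
  of \<open>a\<close>.\<close>

lemma balanced_insert_unique:
  assumes "ys @ zs = ys' @ zs'" "num_greater a ys = num_less a zs" "num_greater a ys' = num_less a zs'"
  shows "ys @ a # zs = ys' @ a # zs'"
proof -
  have *: "ys @ a # zs = ys' @ a # zs'"
    if "ys' = ys @ t" "zs = t @ zs'" "num_greater a ys = num_less a zs" "num_greater a ys' = num_less a zs'"
    for ys zs ys' zs' t
  proof -
    have "t = replicate (length t) a"
      using that by (intro num_greater_less_eq_0) auto
    then show ?thesis
      using that by (metis append.assoc replicate_append_Cons_same append_Cons)
  qed
  from assms(1) obtain t where "ys' = ys @ t \<and> zs = t @ zs' \<or> ys = ys' @ t \<and> zs' = t @ zs"
    by (auto simp: append_eq_append_conv2)
  with * [of ys' ys t zs zs'] * [of ys ys' t zs' zs] assms show ?thesis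
    by metis
qed

lemma balanced_remove_unique:
  assumes "ys @ a # zs = ys' @ a # zs'" "num_greater a ys = num_less a zs" "num_greater a ys' = num_less a zs'"
  shows "ys @ zs = ys' @ zs'"
proof -
  have *: "ys @ zs = ys' @ zs'"
    if "ys' = ys @ a # t" "zs = t @ a # zs'" "num_greater a ys = num_less a zs" "num_greater a ys' = num_less a zs'"
    for ys zs ys' zs' t
  proof -
    have "t = replicate (length t) a"
      using that by (intro num_greater_less_eq_0) auto
    then show ?thesis
      using that by (metis append.assoc replicate_append_Cons_same append_Cons)
  qed
  from assms(1) consider "ys = ys'" "zs = zs'" | t where "ys' = ys @ a # t" "zs = t @ a # zs'"
    | t where "ys = ys' @ a # t" "zs' = t @ a # zs"
    by (auto simp: append_eq_append_conv2 append_eq_Cons_conv Cons_eq_append_conv)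
  then show ?thesis
    using * assms by cases metis+
qed

text \<open>By monotonicity in the letter, a balanced \<open>b\<close> left of the balanced cut is
  smaller than \<open>a\<close>, and one right of it is larger. So the inserted \<open>a\<close>
  does not enter the balance of \<open>b\<close>.\<close>

lemma has_fix_insert:
  assumes bal: "num_greater a ys = num_less a zs" and "a \<noteq> b"
  shows "has_fix b (ys @ a # zs) \<longleftrightarrow> has_fix b (ys @ zs)"
proof
  assume "has_fix b (ys @ a # zs)"
  then obtain p q where pq: "ys @ a # zs = p @ b # q" "num_greater b p = num_less b q"
    by (auto simp: has_fix_def)
  then consider r where "ys = p @ b # r" "q = r @ a # zs" | r where "p = ys @ a # r" "zs = r @ b # q"
    using \<open>a \<noteq> b\<close> by (auto simp: append_eq_append_conv2 append_eq_Cons_conv Cons_eq_append_conv)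
  then show "has_fix b (ys @ zs)"
  proof cases
    case 1
    have "\<not> a < b"
      using num_greater_mono [of a b p] num_less_mono [of a b zs] 1 pq bal by auto
    then show ?thesis
      using 1 pq \<open>a \<noteq> b\<close> unfolding has_fix_def
      by (intro exI [of _ p] exI [of _ "r @ zs"]) auto
  next
    case 2
    have "\<not> b < a"
      using num_greater_mono [of b a ys] num_less_mono [of b a q] 2 pq bal by auto
    then show ?thesis
      using 2 pq \<open>a \<noteq> b\<close> unfolding has_fix_def
      by (intro exI [of _ "ys @ r"] exI [of _ q]) auto
  qed
next
  assume "has_fix b (ys @ zs)"
  then obtain p q where pq: "ys @ zs = p @ b # q" "num_greater b p = num_less b q"
    by (auto simp: has_fix_def)
  then consider r where "ys = p @ b # r" "q = r @ zs" | r where "p = ys @ r" "zs = r @ b # q"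
    by (auto simp: append_eq_append_conv2 append_eq_Cons_conv Cons_eq_append_conv)
  then show "has_fix b (ys @ a # zs)"
  proof cases
    case 1
    have "\<not> a < b"
      using num_greater_mono [of a b p] num_less_mono [of a b zs] 1 pq bal by auto
    then show ?thesis
      using 1 pq \<open>a \<noteq> b\<close> unfolding has_fix_def
      by (intro exI [of _ p] exI [of _ "r @ a # zs"]) auto
  next
    case 2
    have "\<not> b < a"
      using num_greater_mono [of b a ys] num_less_mono [of b a q] 2 pq bal by auto
    then show ?thesis
      using 2 pq \<open>a \<noteq> b\<close> unfolding has_fix_def
      by (intro exI [of _ "ys @ a # r"] exI [of _ q]) auto
  qed
qed

section \<open>Counting words without fixed points\<close>

definition words :: "nat \<Rightarrow> nat \<Rightarrow> nat list set" where
  "words m n = {xs. set xs \<subseteq> {..<m} \<and> length xs = n}"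

lemma finite_words [simp]: "finite (words m n)"
  unfolding words_def by (rule finite_lists_length_eq) simp

lemma card_words: "card (words m n) = m ^ n"
  unfolding words_def by (simp add: card_lists_length_eq)

text \<open>Only the letters in \<open>A\<close> are forbidden as fixed points, which allows
  induction on \<open>A\<close>; derangements correspond to \<open>A = {..<m}\<close>.\<close>

definition fix_free_words :: "nat set \<Rightarrow> nat \<Rightarrow> nat \<Rightarrow> nat list set" where
  "fix_free_words A m n = {xs \<in> words m n. \<forall>a\<in>A. \<not> has_fix a xs}"

lemma finite_fix_free_words [simp]: "finite (fix_free_words A m n)"
  by (simp add: fix_free_words_def)

text \<open>Inserting \<open>a\<close> at a balanced cut is a bijection from the shorter words. The
  cut chosen by \<open>SOME\<close> is immaterial by \<open>balanced_insert_unique\<close>.\<close>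

lemma card_has_fix:
  assumes a: "a < m" "a \<notin> A"
  shows "card {xs \<in> fix_free_words A m (Suc n). has_fix a xs} = card (fix_free_words A m n)"
proof -
  define split where "split xs = (SOME p. xs = fst p @ snd p \<and> num_greater a (fst p) = num_less a (snd p))"
    for xs :: "nat list"
  have split: "xs = fst (split xs) @ snd (split xs)"
    "num_greater a (fst (split xs)) = num_less a (snd (split xs))" for xs
  proof -
    have "\<exists>p. xs = fst p @ snd p \<and> num_greater a (fst p) = num_less a (snd p)"
      using balanced_split_exists [of xs a] by auto
    from someI_ex [OF this] show "xs = fst (split xs) @ snd (split xs)"
      "num_greater a (fst (split xs)) = num_less a (snd (split xs))"
      unfolding split_def by blast+
  qed
  define ins where "ins xs = fst (split xs) @ a # snd (split xs)" for xs
  have ins_eq: "ins (ys @ zs) = ys @ a # zs" if "num_greater a ys = num_less a zs" for ys zs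
    unfolding ins_def using that split [of "ys @ zs"] by (intro balanced_insert_unique) auto
  have "bij_betw ins (fix_free_words A m n) {xs \<in> fix_free_words A m (Suc n). has_fix a xs}"
    unfolding bij_betw_def
  proof (intro conjI set_eqI iffI)
    show "inj_on ins (fix_free_words A m n)"
    proof (rule inj_onI)
      fix xs ys assume "ins xs = ins ys"
      then show "xs = ys"
        using balanced_remove_unique [of "fst (split xs)" a "snd (split xs)" "fst (split ys)" "snd (split ys)"]
          split by (simp add: ins_def)
    qed
  next
    fix u assume "u \<in> ins ` fix_free_words A m n"
    then obtain xs where xs: "xs \<in> fix_free_words A m n" "u = ins xs"
      by blast
    define ys zs where "ys = fst (split xs)" and "zs = snd (split xs)"
    have u: "u = ys @ a # zs" "ys @ zs \<in> fix_free_words A m n"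
      and bal: "num_greater a ys = num_less a zs"
      using xs split [of xs] by (simp_all add: ins_def ys_def zs_def)
    have "\<forall>b\<in>A. has_fix b (ys @ a # zs) = has_fix b (ys @ zs)"
      using has_fix_insert [OF bal] a by metis
    moreover have "has_fix a u"
      using u bal by (auto simp: has_fix_def)
    ultimately show "u \<in> {xs \<in> fix_free_words A m (Suc n). has_fix a xs}"
      using u a by (auto simp: fix_free_words_def words_def)
  next
    fix u assume u: "u \<in> {xs \<in> fix_free_words A m (Suc n). has_fix a xs}"
    then obtain ys zs where yz: "u = ys @ a # zs" and bal: "num_greater a ys = num_less a zs"
      by (auto simp: has_fix_def)
    have "\<forall>b\<in>A. has_fix b (ys @ a # zs) = has_fix b (ys @ zs)"
      using has_fix_insert [OF bal] a by metis
    then have "ys @ zs \<in> fix_free_words A m n"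
      using u yz by (auto simp: fix_free_words_def words_def)
    then show "u \<in> ins ` fix_free_words A m n"
      unfolding yz by (intro image_eqI [where x = "ys @ zs"]) (simp_all add: ins_eq [OF bal])
  qed
  then show ?thesis
    by (simp add: bij_betw_same_card)
qed

lemma card_fix_free_words_insert:
  assumes "a < m" "a \<notin> A"
  shows "int (card (fix_free_words (insert a A) m (Suc n)))
    = int (card (fix_free_words A m (Suc n))) - int (card (fix_free_words A m n))"
proof -
  have "fix_free_words A m (Suc n)
      = fix_free_words (insert a A) m (Suc n) \<union> {xs \<in> fix_free_words A m (Suc n). has_fix a xs}"
    by (auto simp: fix_free_words_def)
  then have "card (fix_free_words A m (Suc n))
      = card (fix_free_words (insert a A) m (Suc n) \<union> {xs \<in> fix_free_words A m (Suc n). has_fix a xs})"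
    by (rule arg_cong)
  also have "\<dots> = card (fix_free_words (insert a A) m (Suc n))
      + card {xs \<in> fix_free_words A m (Suc n). has_fix a xs}"
    by (rule card_Un_disjoint) (auto simp: fix_free_words_def)
  finally show ?thesis
    using card_has_fix [OF assms] by simp
qed

lemma card_fix_free_words_0: "card (fix_free_words A m 0) = 1"
proof -
  have "fix_free_words A m 0 = {[]}"
    by (auto simp: fix_free_words_def words_def has_fix_def)
  then show ?thesis
    by simp
qed

text \<open>Enlarging \<open>A\<close> by a letter changes the counts by
  \<open>card_fix_free_words_insert\<close> and the binomial by Pascal's rule, and the two changes
  agree.\<close>

lemma card_fix_free_words_Suc:
  assumes "finite A" "A \<subseteq> {..<m}"
  shows "int (card (fix_free_words A m (Suc n)))
    = int m * int (card (fix_free_words A m n)) + (- 1) ^ Suc n * int (card A choose Suc n)"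
  using assms
proof (induction A arbitrary: n rule: finite_induct)
  case empty
  then show ?case
    by (simp add: fix_free_words_def card_words)
next
  case (insert a A)
  show ?case
  proof (cases n)
    case 0
    then show ?thesis
      using insert card_fix_free_words_insert [of a m A 0]
      by (simp add: card_fix_free_words_0)
  next
    case (Suc k)
    have A: "A \<subseteq> {..<m}" and a: "a < m" "a \<notin> A"
      using insert by auto
    have "int (card (fix_free_words A m n))
        = int m * int (card (fix_free_words A m k)) + (- 1) ^ n * int (card A choose n)"
      using insert.IH [OF A, of k] Suc by simp
    moreover have "int (card (fix_free_words (insert a A) m n))
        = int (card (fix_free_words A m n)) - int (card (fix_free_words A m k))"
      using card_fix_free_words_insert [OF a, of k] Suc by simp
    moreover have "int (card (insert a A) choose Suc n) = int (card A choose n) + int (card A choose Suc n)"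
      using insert by simp
    ultimately show ?thesis
      using insert.IH [OF A, of n] card_fix_free_words_insert [OF a, of n]
      by (simp only: power_Suc) (simp add: algebra_simps)
  qed
qed

section \<open>Standardization\<close>

text \<open>\<open>d\<close> marks the steps that must be strict. With \<open>d\<close> the descents
  of \<pi>, these are the letters of a word read in the order \<pi>.\<close>

definition is_chain :: "(nat \<Rightarrow> bool) \<Rightarrow> nat \<Rightarrow> (nat \<Rightarrow> nat) \<Rightarrow> bool" where
  "is_chain d i w \<longleftrightarrow>
    (\<forall>j. 1 \<le> j \<and> j < i \<longrightarrow> (if d j then w j < w (Suc j) else w j \<le> w (Suc j)))"

lemma is_chain_Suc:
  "k \<ge> 1 \<Longrightarrow> is_chain d (Suc k) w \<longleftrightarrow>
    is_chain d k w \<and> (if d k then w k < w (Suc k) else w k \<le> w (Suc k))"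
  by (auto simp: is_chain_def less_Suc_eq)

lemma is_chain_cong: "(\<And>j. 1 \<le> j \<Longrightarrow> j \<le> i \<Longrightarrow> v j = w j) \<Longrightarrow> is_chain d i v \<longleftrightarrow> is_chain d i w"
  by (auto simp: is_chain_def)

lemma is_chain_mono:
  assumes "is_chain d i w" and "1 \<le> j" "j \<le> k" "k \<le> i"
  shows "w j \<le> w k"
  using \<open>j \<le> k\<close> \<open>k \<le> i\<close>
proof (induction k rule: dec_induct)
  case (step k)
  moreover have "w k \<le> w (Suc k)"
    using assms(1,2) step by (auto simp: is_chain_def dest!: spec [of _ k] split: if_splits)
  ultimately show ?case
    by simp
qed simp

definition bounded_chains :: "(nat \<Rightarrow> bool) \<Rightarrow> nat \<Rightarrow> nat \<Rightarrow> (nat \<Rightarrow> nat) set" where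
  "bounded_chains d i M = {w \<in> {1..i} \<rightarrow>\<^sub>E {..<M}. is_chain d i w}"

lemma finite_bounded_chains [simp]: "finite (bounded_chains d i M)"
  unfolding bounded_chains_def by (rule finite_subset [OF _ finite_PiE [of "{1..i}" "\<lambda>_. {..<M}"]]) auto

lemma bounded_chains_iff:
  assumes "i \<ge> 1"
  shows "w \<in> bounded_chains d i M \<longleftrightarrow> w \<in> extensional {1..i} \<and> is_chain d i w \<and> w i < M"
proof
  assume "w \<in> extensional {1..i} \<and> is_chain d i w \<and> w i < M"
  moreover from this have "w j < M" if "1 \<le> j" "j \<le> i" for j
    using is_chain_mono [of d i w j i] that by auto
  ultimately show "w \<in> bounded_chains d i M"
    by (auto simp: bounded_chains_def PiE_iff)
qed (use assms in \<open>auto simp: bounded_chains_def PiE_iff\<close>)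

text \<open>Split by whether the last value is the top value \<open>M\<close>; a strict last step
  then lowers the bound for the rest.\<close>

lemma bounded_chains_Suc_Suc:
  assumes "k \<ge> 1"
  shows "bounded_chains d (Suc k) (Suc M) = bounded_chains d (Suc k) M
    \<union> (\<lambda>w. w(Suc k := M)) ` bounded_chains d k (if d k then M else Suc M)" (is "?L = ?A \<union> ?B")
proof (intro equalityI subsetI)
  fix w assume w: "w \<in> ?L"
  show "w \<in> ?A \<union> ?B"
  proof (cases "w (Suc k) = M")
    case False
    then show ?thesis
      using w by (simp add: bounded_chains_iff)
  next
    case True
    define v where "v = restrict w {1..k}"
    have "w = v(Suc k := M)"
      using w True by (auto simp: v_def bounded_chains_iff fun_eq_iff extensional_def)
    moreover have "v \<in> bounded_chains d k (if d k then M else Suc M)"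
      using w assms True is_chain_cong [of k v w d]
      by (auto simp: v_def bounded_chains_iff is_chain_Suc split: if_splits)
    ultimately show ?thesis
      by blast
  qed
next
  fix w assume "w \<in> ?A \<union> ?B"
  then show "w \<in> ?L"
  proof
    assume "w \<in> ?A"
    then show ?thesis
      by (auto simp: bounded_chains_iff)
  next
    assume "w \<in> ?B"
    then obtain v where v: "v \<in> bounded_chains d k (if d k then M else Suc M)" and w: "w = v(Suc k := M)"
      by blast
    have "w \<in> extensional {1..Suc k}"
      using v w assms by (auto simp: bounded_chains_iff extensional_def)
    then show ?thesis
      using v w assms is_chain_cong [of k v w d]
      by (auto simp: bounded_chains_iff is_chain_Suc split: if_splits)
  qed
qed

text \<open>The split at the top value is Pascal's rule, and both parts have smaller
  \<open>i + M\<close>. The bound \<open>D_le\<close> keeps the subtractions from being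
  truncated.\<close>

lemma card_bounded_chains:
  assumes "i \<ge> 1"
  shows "card (bounded_chains d i M) = (M + i - 1 - card {j. 1 \<le> j \<and> j < i \<and> d j}) choose i"
  using assms
proof (induction "i + M" arbitrary: i M rule: less_induct)
  case less
  define D where "D i = card {j. 1 \<le> j \<and> j < i \<and> d j}" for i
  have D_le: "D i \<le> i - 1" for i
    unfolding D_def by (rule order.trans [OF card_mono [of "{1..<i}"]]) auto
  consider "i = 1" | "i > 1" "M = 0" | k M' where "i = Suc k" "k \<ge> 1" "M = Suc M'"
    using less.prems by (cases i; cases M; cases "i = 1") auto
  then show ?case
  proof cases
    case 1
    have "bounded_chains d i M = {1..1} \<rightarrow>\<^sub>E {..<M}"
      using 1 by (auto simp: bounded_chains_def is_chain_def)
    then have "card (bounded_chains d i M) = M"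
      by (simp add: card_PiE)
    then show ?thesis
      unfolding D_def [symmetric] using 1 D_le [of 1] by simp
  next
    case 2
    then have "bounded_chains d i M = {}"
      by (auto simp: bounded_chains_def PiE_iff)
    then show ?thesis
      using 2 by simp
  next
    case 3
    have inj: "inj_on (\<lambda>w. w(Suc k := M')) (bounded_chains d k (if d k then M' else Suc M'))"
      by (rule inj_onI) (use 3 in \<open>auto simp: bounded_chains_iff extensional_def fun_eq_iff split: if_splits\<close>; metis Suc_n_not_le_n)
    have disj: "bounded_chains d (Suc k) M' \<inter> (\<lambda>w. w(Suc k := M')) ` bounded_chains d k (if d k then M' else Suc M') = {}"
      by (auto simp: bounded_chains_iff)
    have Dk: "D (Suc k) = (if d k then Suc (D k) else D k)"
    proof -
      have "{j. 1 \<le> j \<and> j < Suc k \<and> d j} = (if d k then insert k else id) {j. 1 \<le> j \<and> j < k \<and> d j}"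
        using 3 by (auto simp: less_Suc_eq)
      then show ?thesis
        by (simp add: D_def)
    qed
    have "card (bounded_chains d i M) = card (bounded_chains d (Suc k) M') + card (bounded_chains d k (if d k then M' else Suc M'))"
      using 3 disj by (simp only: bounded_chains_Suc_Suc card_Un_disjoint finite_bounded_chains finite_imageI card_image [OF inj])
    also have "card (bounded_chains d (Suc k) M') = (M' + Suc k - 1 - D (Suc k)) choose Suc k"
      unfolding D_def using 3 by (intro less.hyps) auto
    also have "card (bounded_chains d k (if d k then M' else Suc M')) = ((if d k then M' else Suc M') + k - 1 - D k) choose k"
      unfolding D_def using 3 by (intro less.hyps) auto
    also have "(if d k then M' else Suc M') + k - 1 - D k = M' + Suc k - 1 - D (Suc k)"
      using 3 by (auto simp: Dk)
    finally have "card (bounded_chains d i M) = Suc (M' + Suc k - 1 - D (Suc k)) choose Suc k"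
      by simp
    also have "Suc (M' + Suc k - 1 - D (Suc k)) = M + i - 1 - D i"
      using D_le [of "Suc k"] 3 by simp
    finally show ?thesis
      using 3 by (simp add: D_def)
  qed
qed

text \<open>Orders positions lexicographically by letter and position; positions are counted from 1.\<close>
definition word_key :: "nat list \<Rightarrow> nat \<Rightarrow> nat" where
  "word_key xs p = xs ! (p - 1) * Suc (length xs) + p"

text \<open>Positions are at most \<open>length xs\<close>, so letter and position act as digits in
  base \<open>Suc (length xs)\<close>.\<close>

lemma word_key_less:
  assumes "p \<le> length xs" "q \<le> length xs"
  shows "word_key xs p < word_key xs q \<longleftrightarrow>
    xs ! (p - 1) < xs ! (q - 1) \<or> xs ! (p - 1) = xs ! (q - 1) \<and> p < q"
proof -
  have less: "a * Suc n + i < b * Suc n + j" if "a < b" "i \<le> n" for a b i j n :: nat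
  proof -
    have "a * Suc n + i < Suc a * Suc n"
      using that by simp
    also have "\<dots> \<le> b * Suc n"
      using that by (intro mult_le_mono1) simp
    finally show ?thesis
      by simp
  qed
  show ?thesis
    using less [of "xs ! (p - 1)" "xs ! (q - 1)" p "length xs" q]
      less [of "xs ! (q - 1)" "xs ! (p - 1)" q "length xs" p] assms
    unfolding word_key_def by (cases "xs ! (p - 1)" "xs ! (q - 1)" rule: linorder_cases) auto
qed

definition std :: "nat list \<Rightarrow> nat \<Rightarrow> nat" where
  "std xs p = (if p \<in> {1..length xs}
     then card {q \<in> {1..length xs}. word_key xs q \<le> word_key xs p} else p)"

lemma std_less:
  assumes "p \<in> {1..length xs}" "q \<in> {1..length xs}"
  shows "std xs p < std xs q \<longleftrightarrow> word_key xs p < word_key xs q"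
proof -
  have less: "std xs p < std xs q"
    if "p \<in> {1..length xs}" "q \<in> {1..length xs}" "word_key xs p < word_key xs q" for p q
  proof -
    let ?A = "\<lambda>p. {r \<in> {1..length xs}. word_key xs r \<le> word_key xs p}"
    have "?A p \<subseteq> ?A q" "q \<in> ?A q" "q \<notin> ?A p"
      using that by auto
    then have "?A p \<subset> ?A q"
      by blast
    then have "card (?A p) < card (?A q)"
      by (intro psubset_card_mono) auto
    then show ?thesis
      using that by (simp add: std_def)
  qed
  have "std xs p = std xs q" if "word_key xs p = word_key xs q"
    using assms that by (simp add: std_def)
  then show ?thesis
    using less assms by (metis linorder_less_linear order_less_asym' order_less_irrefl)
qed

lemma word_key_inj: "inj_on (word_key xs) {1..length xs}"
proof (rule inj_on_inverseI)
  fix p assume "p \<in> {1..length xs}"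
  then show "word_key xs p mod Suc (length xs) = p"
    by (simp add: word_key_def del: mult_Suc_right)
qed

lemma std_permutes: "std xs permutes {1..length xs}"
proof (rule bij_imp_permutes)
  have "inj_on (std xs) {1..length xs}"
  proof (rule inj_onI)
    fix p q assume "p \<in> {1..length xs}" "q \<in> {1..length xs}" "std xs p = std xs q"
    then show "p = q"
      using std_less [of p xs q] std_less [of q xs p] word_key_inj [of xs]
      by (metis inj_onD less_irrefl linorder_neqE_nat)
  qed
  moreover have "std xs ` {1..length xs} \<subseteq> {1..length xs}"
  proof
    fix r assume "r \<in> std xs ` {1..length xs}"
    then obtain p where p: "p \<in> {1..length xs}" "r = card {q \<in> {1..length xs}. word_key xs q \<le> word_key xs p}"
      by (auto simp: std_def)
    let ?A = "{q \<in> {1..length xs}. word_key xs q \<le> word_key xs p}"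
    have "card ?A \<le> card {1..length xs}"
      by (intro card_mono) auto
    moreover have "?A \<noteq> {}"
      using p(1) by blast
    then have "card ?A > 0"
      by (simp add: card_gt_0_iff del: atLeastAtMost_iff)
    ultimately show "r \<in> {1..length xs}"
      using p(2) by simp
  qed
  ultimately show "bij_betw (std xs) {1..length xs} {1..length xs}"
    by (simp add: bij_betw_def endo_inj_surj)
qed (auto simp: std_def)

text \<open>The inverse of the rank function lists the positions by increasing key, and such a
  listing is unique.\<close>

lemma inv_std_eq_iff:
  assumes \<pi>: "\<pi> permutes {1..length xs}"
  shows "inv (std xs) = \<pi> \<longleftrightarrow>
    (\<forall>i. 1 \<le> i \<and> i < length xs \<longrightarrow> word_key xs (\<pi> i) < word_key xs (\<pi> (Suc i)))"
proof
  have in_range: "\<pi> i \<in> {1..length xs}" if "i \<in> {1..length xs}" for i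
    using that permutes_in_image [OF \<pi>] by blast
  {
    assume "inv (std xs) = \<pi>"
    then have "std xs (\<pi> i) = i" for i
      using std_permutes [of xs] by (metis permutes_inverses(1))
    then show "\<forall>i. 1 \<le> i \<and> i < length xs \<longrightarrow> word_key xs (\<pi> i) < word_key xs (\<pi> (Suc i))"
      using std_less [OF in_range in_range] by (metis Suc_leI atLeastAtMost_iff le_SucI lessI less_imp_le_nat)
  next
    assume chain: "\<forall>i. 1 \<le> i \<and> i < length xs \<longrightarrow> word_key xs (\<pi> i) < word_key xs (\<pi> (Suc i))"
    have less: "word_key xs (\<pi> i) < word_key xs (\<pi> j)" if "1 \<le> i" "i < j" "j \<le> length xs" for i j
      using Suc_leI [OF \<open>i < j\<close>] \<open>j \<le> length xs\<close>
    proof (induction j rule: dec_induct)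
      case base
      then show ?case
        using chain \<open>1 \<le> i\<close> by simp
    next
      case (step k)
      then have "word_key xs (\<pi> k) < word_key xs (\<pi> (Suc k))"
        using chain \<open>1 \<le> i\<close> by simp
      then show ?case
        using step by simp
    qed
    have "std xs (\<pi> i) = i" for i
    proof (cases "i \<in> {1..length xs}")
      case True
      have "word_key xs (\<pi> j) \<le> word_key xs (\<pi> i) \<longleftrightarrow> j \<le> i" if "j \<in> {1..length xs}" for j
        using less [of i j] less [of j i] True that by (cases i j rule: linorder_cases) auto
      then have "{q \<in> {1..length xs}. word_key xs q \<le> word_key xs (\<pi> i)} = \<pi> ` {1..i}"
      proof (intro equalityI subsetI)
        fix q assume q: "q \<in> {q \<in> {1..length xs}. word_key xs q \<le> word_key xs (\<pi> i)}"
        then obtain j where "j \<in> {1..length xs}" "q = \<pi> j"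
          using permutes_image [OF \<pi>] by blast
        then show "q \<in> \<pi> ` {1..i}"
          using q \<open>\<And>j. j \<in> {1..length xs} \<Longrightarrow> word_key xs (\<pi> j) \<le> word_key xs (\<pi> i) \<longleftrightarrow> j \<le> i\<close>
          by auto
      next
        fix q assume "q \<in> \<pi> ` {1..i}"
        then obtain j where "j \<in> {1..i}" "q = \<pi> j"
          by blast
        then show "q \<in> {q \<in> {1..length xs}. word_key xs q \<le> word_key xs (\<pi> i)}"
          using True in_range [of j] \<open>\<And>j. j \<in> {1..length xs} \<Longrightarrow> word_key xs (\<pi> j) \<le> word_key xs (\<pi> i) \<longleftrightarrow> j \<le> i\<close>
          by auto
      qed
      then have "std xs (\<pi> i) = card (\<pi> ` {1..i})"
        using in_range [OF True] by (simp add: std_def)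
      also have "\<dots> = i"
        using permutes_inj_on [OF \<pi>] by (simp add: card_image)
      finally show ?thesis .
    next
      case False
      then show ?thesis
        using permutes_not_in [OF \<pi>] by (simp add: std_def del: atLeastAtMost_iff)
    qed
    then show "inv (std xs) = \<pi>"
      using permutes_inverses(2) [OF std_permutes [of xs]] by (metis ext)
  }
qed

lemma card_filter_shift:
  "card {q \<in> {Suc k..k + length xs}. P (xs ! (q - Suc k))} = length (filter P xs)"
proof -
  have "{q \<in> {Suc k..k + length xs}. P (xs ! (q - Suc k))} = (\<lambda>i. i + Suc k) ` {i. i < length xs \<and> P (xs ! i)}"
  proof (intro equalityI subsetI)
    fix q assume "q \<in> {q \<in> {Suc k..k + length xs}. P (xs ! (q - Suc k))}"
    then show "q \<in> (\<lambda>i. i + Suc k) ` {i. i < length xs \<and> P (xs ! i)}"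
      by (intro image_eqI [of _ _ "q - Suc k"]) auto
  qed auto
  then show ?thesis
    by (simp add: length_filter_conv_card card_image inj_on_def)
qed

text \<open>The rank of the marked \<open>a\<close> counts the positions up to it, except those with
  larger letters, and the later positions with smaller letters. Hence it is a fixed point exactly
  when the cut is balanced.\<close>

lemma std_split:
  "std (ys @ a # zs) (Suc (length ys)) + num_greater a ys = Suc (length ys) + num_less a zs"
proof -
  let ?xs = "ys @ a # zs" and ?p = "Suc (length ys)"
  have "std ?xs ?p = card {q \<in> {1..length ?xs}. word_key ?xs q \<le> word_key ?xs ?p}"
    by (simp add: std_def)
  also have "{q \<in> {1..length ?xs}. word_key ?xs q \<le> word_key ?xs ?p}
      = ({1..?p} - {q \<in> {Suc 0..0 + length ys}. a < ys ! (q - Suc 0)})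
        \<union> {q \<in> {Suc ?p..?p + length zs}. zs ! (q - Suc ?p) < a}"
  proof (rule set_eqI)
    fix q
    have key: "word_key ?xs q \<le> word_key ?xs ?p \<longleftrightarrow>
        \<not> (a < ?xs ! (q - 1) \<or> a = ?xs ! (q - 1) \<and> ?p < q)" if "q \<le> length ?xs"
      using word_key_less [of ?p ?xs q] that by (simp add: not_less [symmetric] nth_append)
    consider "q = 0" | "1 \<le> q" "q \<le> length ys" | "q = ?p" | "?p < q" "q \<le> length ?xs" | "q > length ?xs"
      by linarith
    then show "q \<in> {q \<in> {1..length ?xs}. word_key ?xs q \<le> word_key ?xs ?p} \<longleftrightarrow>
      q \<in> ({1..?p} - {q \<in> {Suc 0..0 + length ys}. a < ys ! (q - Suc 0)})
        \<union> {q \<in> {Suc ?p..?p + length zs}. zs ! (q - Suc ?p) < a}"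
    proof cases
      case 2
      then have "q - 1 < length ys"
        by linarith
      then have "?xs ! (q - 1) = ys ! (q - Suc 0)"
        by (simp add: nth_append)
      then show ?thesis
        using key 2 by simp
    next
      case 3
      then show ?thesis
        by simp
    next
      case 4
      then have "?xs ! (q - 1) = zs ! (q - Suc ?p)"
        by (auto simp: nth_append nth_Cons' numeral_2_eq_2)
      then show ?thesis
        using key 4 by (simp add: not_less le_less) linarith
    qed auto
  qed
  also have "card \<dots> = card ({1..?p} - {q \<in> {Suc 0..0 + length ys}. a < ys ! (q - Suc 0)})
      + card {q \<in> {Suc ?p..?p + length zs}. zs ! (q - Suc ?p) < a}"
    by (intro card_Un_disjoint) auto
  also have "card ({1..?p} - {q \<in> {Suc 0..0 + length ys}. a < ys ! (q - Suc 0)}) = ?p - num_greater a ys"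
    unfolding num_greater_def card_filter_shift [of 0 ys, symmetric]
    by (subst card_Diff_subset) auto
  also have "card {q \<in> {Suc ?p..?p + length zs}. zs ! (q - Suc ?p) < a} = num_less a zs"
    unfolding num_less_def by (rule card_filter_shift)
  finally have "std ?xs ?p = ?p - num_greater a ys + num_less a zs" .
  moreover have "num_greater a ys \<le> length ys"
    by (simp add: num_greater_def)
  ultimately show ?thesis
    by simp
qed

lemma has_fix_iff_std:
  "(\<exists>a. has_fix a xs) \<longleftrightarrow> (\<exists>p\<in>{1..length xs}. std xs p = p)"
proof
  assume "\<exists>a. has_fix a xs"
  then obtain a ys zs where *: "xs = ys @ a # zs" "num_greater a ys = num_less a zs"
    by (auto simp: has_fix_def)
  then have "std xs (Suc (length ys)) = Suc (length ys)"
    using std_split [of ys a zs] by simp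
  then show "\<exists>p\<in>{1..length xs}. std xs p = p"
    using * by (intro bexI [of _ "Suc (length ys)"]) auto
next
  assume "\<exists>p\<in>{1..length xs}. std xs p = p"
  then obtain p where p: "p \<in> {1..length xs}" "std xs p = p" ..
  define ys zs where "ys = take (p - 1) xs" and "zs = drop p xs"
  have *: "xs = ys @ xs ! (p - 1) # zs" "Suc (length ys) = p"
    using p(1) id_take_nth_drop [of "p - 1" xs] by (auto simp: ys_def zs_def)
  then have "num_greater (xs ! (p - 1)) ys = num_less (xs ! (p - 1)) zs"
    using std_split [of ys "xs ! (p - 1)" zs] p(2) by simp
  then show "\<exists>a. has_fix a xs"
    using * by (auto simp: has_fix_def)
qed

lemma fix_free_words_iff_derangement:
  assumes "xs \<in> words m n"
  shows "xs \<in> fix_free_words {..<m} m n \<longleftrightarrow> inv (std xs) \<in> derangements n"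
proof -
  have n: "length xs = n"
    using assms by (simp add: words_def)
  have "a < m" if "has_fix a xs" for a
    using that assms by (auto simp: has_fix_def words_def)
  then have "xs \<in> fix_free_words {..<m} m n \<longleftrightarrow> \<not> (\<exists>a. has_fix a xs)"
    using assms by (auto simp: fix_free_words_def)
  also have "\<dots> \<longleftrightarrow> (\<forall>p\<in>{1..n}. std xs p \<noteq> p)"
    unfolding has_fix_iff_std n by blast
  also have "\<dots> \<longleftrightarrow> inv (std xs) \<in> derangements n"
    using permutes_inv [OF std_permutes [of xs]] permutes_inv_eq [OF std_permutes [of xs]]
    by (auto simp: derangements_def n)
  finally show ?thesis .
qed

text \<open>Read along \<pi>, such a word increases weakly; equal letters are sorted by position, so
  the increase is strict exactly where \<pi> descends. This gives a bijection with bounded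
  chains.\<close>

lemma card_std_fibre:
  assumes \<pi>: "\<pi> permutes {1..n}" and "n \<ge> 1"
  shows "card {xs \<in> words m n. inv (std xs) = \<pi>} = (m + n - 1 - des n \<pi>) choose n"
proof -
  let ?d = "\<lambda>i. \<pi> i > \<pi> (i + 1)"
  have in_range: "\<pi> i \<in> {1..n}" if "i \<in> {1..n}" for i
    using that permutes_in_image [OF \<pi>] by blast
  have eq: "inv (std xs) = \<pi> \<longleftrightarrow> is_chain ?d n (\<lambda>i. xs ! (\<pi> i - 1))" if "length xs = n" for xs
  proof -
    have "word_key xs (\<pi> i) < word_key xs (\<pi> (Suc i)) \<longleftrightarrow>
        (if ?d i then xs ! (\<pi> i - 1) < xs ! (\<pi> (Suc i) - 1) else xs ! (\<pi> i - 1) \<le> xs ! (\<pi> (Suc i) - 1))"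
      if i: "1 \<le> i" "i < n" for i
    proof -
      have "\<pi> i \<noteq> \<pi> (Suc i)"
        by (simp add: inj_eq [OF permutes_inj [OF \<pi>]])
      then have "\<not> ?d i \<longleftrightarrow> \<pi> i < \<pi> (Suc i)"
        by auto
      moreover have "word_key xs (\<pi> i) < word_key xs (\<pi> (Suc i)) \<longleftrightarrow> xs ! (\<pi> i - 1) < xs ! (\<pi> (Suc i) - 1)
          \<or> xs ! (\<pi> i - 1) = xs ! (\<pi> (Suc i) - 1) \<and> \<pi> i < \<pi> (Suc i)"
        using in_range [of i] in_range [of "Suc i"] i \<open>length xs = n\<close> by (intro word_key_less) auto
      ultimately show ?thesis
        by (simp only: le_less) metis
    qed
    then show ?thesis
      using inv_std_eq_iff [of \<pi> xs] \<pi> that by (auto simp: is_chain_def)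
  qed
  let ?f = "\<lambda>xs. restrict (\<lambda>i. xs ! (\<pi> i - 1)) {1..n}"
  let ?g = "\<lambda>w. map (\<lambda>p. w (inv \<pi> p)) [1..<Suc n]"
  have "bij_betw ?f {xs \<in> words m n. inv (std xs) = \<pi>} (bounded_chains ?d n m)"
  proof (rule bij_betw_byWitness [where f' = ?g])
    have g_nth: "?g w ! (\<pi> i - 1) = w i" if "i \<in> {1..n}" for w i
    proof -
      have i: "\<pi> i - 1 < n" "1 + (\<pi> i - 1) = \<pi> i"
        using in_range [OF that] by auto
      then have "?g w ! (\<pi> i - 1) = w (inv \<pi> (1 + (\<pi> i - 1)))"
        by (simp only: nth_map nth_upt length_upt diff_Suc_1)
      then show ?thesis
        using i permutes_inverses(2) [OF \<pi>] by simp
    qed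
    have inv_range: "inv \<pi> p \<in> {1..n}" if "p \<in> {1..n}" for p
      using that permutes_in_image [OF permutes_inv [OF \<pi>]] by blast
    show "\<forall>xs\<in>{xs \<in> words m n. inv (std xs) = \<pi>}. ?g (?f xs) = xs"
    proof
      fix xs assume "xs \<in> {xs \<in> words m n. inv (std xs) = \<pi>}"
      then have "length xs = n"
        by (simp add: words_def)
      then show "?g (?f xs) = xs"
        using inv_range permutes_inverses(1) [OF \<pi>]
        by (intro nth_equalityI) (auto simp del: upt_Suc)
    qed
    show "\<forall>w\<in>bounded_chains ?d n m. ?f (?g w) = w"
    proof
      fix w assume "w \<in> bounded_chains ?d n m"
      then have w: "w \<in> extensional {1..n}"
        by (auto simp: bounded_chains_def PiE_iff)
      show "?f (?g w) = w"
        using g_nth by (intro extensionalityI [OF _ w]) (auto simp del: upt_Suc)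
    qed
    show "?f ` {xs \<in> words m n. inv (std xs) = \<pi>} \<subseteq> bounded_chains ?d n m"
    proof (rule image_subsetI)
      fix xs assume xs: "xs \<in> {xs \<in> words m n. inv (std xs) = \<pi>}"
      then have "length xs = n" "set xs \<subseteq> {..<m}"
        by (auto simp: words_def)
      have "xs ! (\<pi> i - 1) < m" if "i \<in> {1..n}" for i
      proof -
        have "\<pi> i - 1 < length xs"
          unfolding \<open>length xs = n\<close> using in_range [OF that] by auto
        then show ?thesis
          using \<open>set xs \<subseteq> {..<m}\<close> nth_mem by blast
      qed
      moreover have "is_chain ?d n (?f xs)"
        using eq [OF \<open>length xs = n\<close>] xs is_chain_cong [of n "?f xs" "\<lambda>i. xs ! (\<pi> i - 1)" ?d] by auto
      ultimately show "?f xs \<in> bounded_chains ?d n m"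
        by (auto simp: bounded_chains_def)
    qed
    show "?g ` bounded_chains ?d n m \<subseteq> {xs \<in> words m n. inv (std xs) = \<pi>}"
    proof (rule image_subsetI)
      fix w assume w: "w \<in> bounded_chains ?d n m"
      then have "w i < m" if "i \<in> {1..n}" for i
        using that by (auto simp: bounded_chains_def)
      then have "?g w \<in> words m n"
        using inv_range by (auto simp: words_def simp del: upt_Suc)
      moreover have "is_chain ?d n (\<lambda>i. ?g w ! (\<pi> i - 1))"
        using w g_nth is_chain_cong [of n "\<lambda>i. ?g w ! (\<pi> i - 1)" w ?d] by (auto simp: bounded_chains_def simp del: upt_Suc)
      ultimately show "?g w \<in> {xs \<in> words m n. inv (std xs) = \<pi>}"
        using eq [of "?g w"] by (simp del: upt_Suc)
    qed
  qed
  then have "card {xs \<in> words m n. inv (std xs) = \<pi>} = card (bounded_chains ?d n m)"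
    by (rule bij_betw_same_card)
  also have "\<dots> = (m + n - 1 - des n \<pi>) choose n"
    using card_bounded_chains [OF \<open>n \<ge> 1\<close>] by (simp add: des_def conj_assoc)
  finally show ?thesis .
qed

lemma finite_derangements [simp]: "finite (derangements n)"
  unfolding derangements_def by (rule finite_subset [OF _ finite_permutations [of "{1..n}"]]) auto

lemma card_fix_free_words:
  assumes "n \<ge> 1"
  shows "card (fix_free_words {..<m} m n) = (\<Sum>\<pi>\<in>derangements n. (m + n - 1 - des n \<pi>) choose n)"
proof -
  have "card (fix_free_words {..<m} m n)
      = (\<Sum>\<pi>\<in>derangements n. card {xs \<in> fix_free_words {..<m} m n. inv (std xs) = \<pi>})"
    using fix_free_words_iff_derangement
    by (subst card_eq_sum, subst sum.group [symmetric, where g = "\<lambda>xs. inv (std xs)" and T = "derangements n"])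
       (auto simp: fix_free_words_def)
  also have "\<dots> = (\<Sum>\<pi>\<in>derangements n. (m + n - 1 - des n \<pi>) choose n)"
  proof (rule sum.cong)
    fix \<pi> assume \<pi>: "\<pi> \<in> derangements n"
    then have "{xs \<in> fix_free_words {..<m} m n. inv (std xs) = \<pi>} = {xs \<in> words m n. inv (std xs) = \<pi>}"
      using fix_free_words_iff_derangement by (auto simp: fix_free_words_def)
    then show "card {xs \<in> fix_free_words {..<m} m n. inv (std xs) = \<pi>} = (m + n - 1 - des n \<pi>) choose n"
      using \<pi> assms by (simp add: card_std_fibre derangements_def)
  qed simp
  finally show ?thesis .
qed

section \<open>The descent polynomial\<close>

definition descent_count :: "nat \<Rightarrow> nat \<Rightarrow> nat" where
  "descent_count n k = card {\<pi> \<in> derangements n. des n \<pi> = k}"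

lemma des_less: "n \<ge> 1 \<Longrightarrow> des n \<pi> < n"
proof -
  assume "n \<ge> 1"
  have "des n \<pi> \<le> card {1..<n}"
    unfolding des_def by (intro card_mono) auto
  then show ?thesis
    using \<open>n \<ge> 1\<close> by simp
qed

lemma descent_count_eq_0:
  assumes "n \<ge> 1" "k \<ge> n"
  shows "descent_count n k = 0"
proof -
  have "des n \<pi> \<noteq> k" for \<pi>
    using des_less [OF assms(1), of \<pi>] assms(2) by linarith
  then show ?thesis
    by (simp add: descent_count_def)
qed

lemma sum_derangements_des:
  fixes h :: "nat \<Rightarrow> 'a::comm_semiring_1"
  assumes "n \<ge> 1"
  shows "(\<Sum>\<pi>\<in>derangements n. h (des n \<pi>)) = (\<Sum>k<n. of_nat (descent_count n k) * h k)"
proof -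
  have "(\<Sum>\<pi>\<in>derangements n. h (des n \<pi>))
      = (\<Sum>k<n. \<Sum>\<pi>\<in>{\<pi> \<in> derangements n. des n \<pi> = k}. h (des n \<pi>))"
    using des_less [OF assms] by (intro sum.group [symmetric]) auto
  also have "\<dots> = (\<Sum>k<n. of_nat (descent_count n k) * h k)"
    by (intro sum.cong) (auto simp: descent_count_def)
  finally show ?thesis .
qed

text \<open>The system is triangular: at \<open>m = Suc k\<close> the binomial is 1 for index
  \<open>k\<close> and 0 for larger indices.\<close>

lemma binomial_combination_eq_0:
  fixes e :: "nat \<Rightarrow> int"
  assumes zero: "\<And>m. (\<Sum>k<n. e k * int ((m + n - 1 - k) choose n)) = 0" and "k < n"
  shows "e k = 0"
  using \<open>k < n\<close>
proof (induction k rule: less_induct)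
  case (less k)
  have "(\<Sum>j<n. e j * int ((Suc k + n - 1 - j) choose n)) = (\<Sum>j\<in>{k}. e j * int ((Suc k + n - 1 - j) choose n))"
  proof (rule sum.mono_neutral_right)
    show "\<forall>j\<in>{..<n} - {k}. e j * int ((Suc k + n - 1 - j) choose n) = 0"
    proof
      fix j assume "j \<in> {..<n} - {k}"
      then consider "j < k" | "k < j" "j < n"
        by force
      then show "e j * int ((Suc k + n - 1 - j) choose n) = 0"
        by cases (use less in auto)
    qed
  qed (use less.prems in auto)
  also have "\<dots> = e k"
    using less.prems by simp
  finally show ?case
    using zero [of "Suc k"] by simp
qed

text \<open>The Eulerian recurrence with a correction at \<open>k = n\<close>. The case
  \<open>k = 0\<close> is separate because \<open>k - 1\<close> would be truncated.\<close>

definition next_count :: "nat \<Rightarrow> nat \<Rightarrow> int" where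
  "next_count n k = int (Suc k) * int (descent_count n k)
    + (if k = 0 then 0 else int (Suc n - k) * int (descent_count n (k - 1)))
    + (if k = n then (- 1) ^ Suc n else 0)"

text \<open>Kept general in \<open>T\<close> for three uses: binomials, the products of powers of
  \<open>X\<close> and \<open>W\<close>, and the constant 1.\<close>

lemma sum_next_count:
  fixes T :: "nat \<Rightarrow> 'a::comm_ring_1"
  assumes "n \<ge> 1"
  shows "(\<Sum>k<Suc n. of_int (next_count n k) * T k)
    = (\<Sum>k<n. of_nat (descent_count n k) * (of_nat (Suc k) * T k + of_nat (n - k) * T (Suc k)))
      + (- 1) ^ Suc n * T n"
proof -
  have "(\<Sum>k<Suc n. of_int (next_count n k) * T k)
    = (\<Sum>k<Suc n. of_nat (Suc k) * of_nat (descent_count n k) * T k)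
    + (\<Sum>k<Suc n. (if k = 0 then 0 else of_nat (Suc n - k) * of_nat (descent_count n (k - 1))) * T k)
    + (\<Sum>k<Suc n. (if k = n then (- 1) ^ Suc n else 0) * T k)"
    unfolding sum.distrib [symmetric]
    by (intro sum.cong refl) (simp add: next_count_def algebra_simps)
  also have "(\<Sum>k<Suc n. of_nat (Suc k) * of_nat (descent_count n k) * T k)
      = (\<Sum>k<n. of_nat (Suc k) * of_nat (descent_count n k) * T k)"
    using assms by (simp add: descent_count_eq_0)
  also have "(\<Sum>k<Suc n. (if k = 0 then 0 else of_nat (Suc n - k) * of_nat (descent_count n (k - 1))) * T k)
      = (\<Sum>k<n. of_nat (n - k) * of_nat (descent_count n k) * T (Suc k))"
    by (subst sum.lessThan_Suc_shift) simp
  also have "(\<Sum>k<Suc n. (if k = n then (- 1) ^ Suc n else 0) * T k) = (- 1) ^ Suc n * T n"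
    by simp
  also have "(\<Sum>k<n. of_nat (Suc k) * of_nat (descent_count n k) * T k)
      + (\<Sum>k<n. of_nat (n - k) * of_nat (descent_count n k) * T (Suc k))
      = (\<Sum>k<n. of_nat (descent_count n k) * (of_nat (Suc k) * T k + of_nat (n - k) * T (Suc k)))"
    unfolding sum.distrib [symmetric] by (intro sum.cong refl) (simp add: algebra_simps)
  finally show ?thesis .
qed

text \<open>Pascal's rule and absorption leave \<open>Suc k + (M - n) = m\<close> copies of
  \<open>M choose n\<close>; for \<open>M < n\<close> this binomial is 0.\<close>

lemma worpitzky_step:
  assumes "k < n"
  shows "Suc k * ((m + Suc n - 1 - k) choose Suc n) + (n - k) * ((m + Suc n - 1 - Suc k) choose Suc n)
    = m * ((m + n - 1 - k) choose n)"
proof -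
  define M where "M = m + n - 1 - k"
  have M: "m + Suc n - 1 - k = Suc M" "m + Suc n - 1 - Suc k = M" "M + Suc k = m + n"
    using assms by (auto simp: M_def)
  have "Suc k * (Suc M choose Suc n) + (n - k) * (M choose Suc n)
      = Suc k * (M choose n) + (Suc k + (n - k)) * (M choose Suc n)"
    by (simp add: algebra_simps)
  also have "\<dots> = Suc k * (M choose n) + Suc n * (M choose Suc n)"
    using assms by simp
  also have "Suc n * (M choose Suc n) = (M - n) * (M choose n)"
    by (cases M) (simp_all add: Suc_times_binomial binomial_absorb_comp del: binomial_Suc_Suc mult_Suc)
  also have "Suc k * (M choose n) + (M - n) * (M choose n) = m * (M choose n)"
  proof (cases "n \<le> M")
    case True
    then have "Suc k + (M - n) = m"
      using M(3) by linarith
    then show ?thesis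
      by (simp only: add_mult_distrib [symmetric])
  qed (simp add: binomial_eq_0)
  finally show ?thesis
    unfolding M by (simp add: M_def)
qed

text \<open>
  Both sides expand the same polynomial in \<open>m\<close> in the basis \<open>(m + n - k) choose (n + 1)\<close>, \<open>k \<le> n\<close>.
\<close>
lemma descent_count_Suc:
  assumes "n \<ge> 1" "k < Suc n"
  shows "int (descent_count (Suc n) k) = next_count n k"
proof -
  have "(\<Sum>k<Suc n. (int (descent_count (Suc n) k) - next_count n k) * int ((m + Suc n - 1 - k) choose Suc n)) = 0" for m
  proof -
    have ff: "int (card (fix_free_words {..<m} m n)) = (\<Sum>k<n. int (descent_count n k) * int ((m + n - 1 - k) choose n))"
      if "n \<ge> 1" for n
      using card_fix_free_words [OF that, of m] sum_derangements_des [OF that, of "\<lambda>k. int ((m + n - 1 - k) choose n)"]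
      by simp
    have "(\<Sum>k<Suc n. int (descent_count (Suc n) k) * int ((m + Suc n - 1 - k) choose Suc n))
        = int (card (fix_free_words {..<m} m (Suc n)))"
      by (rule ff [symmetric]) simp
    also have "\<dots> = int m * int (card (fix_free_words {..<m} m n)) + (- 1) ^ Suc n * int (m choose Suc n)"
      by (subst card_fix_free_words_Suc) auto
    also have "int m * int (card (fix_free_words {..<m} m n))
        = (\<Sum>k<n. int (descent_count n k) * int (m * ((m + n - 1 - k) choose n)))"
      by (simp add: ff [OF \<open>n \<ge> 1\<close>] sum_distrib_left mult.left_commute)
    also have "\<dots> = (\<Sum>k<n. int (descent_count n k) *
        (int (Suc k) * int ((m + Suc n - 1 - k) choose Suc n) + int (n - k) * int ((m + Suc n - 1 - Suc k) choose Suc n)))"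
    proof (intro sum.cong refl)
      fix k assume "k \<in> {..<n}"
      then show "int (descent_count n k) * int (m * ((m + n - 1 - k) choose n)) = int (descent_count n k) *
        (int (Suc k) * int ((m + Suc n - 1 - k) choose Suc n) + int (n - k) * int ((m + Suc n - 1 - Suc k) choose Suc n))"
        by (simp only: worpitzky_step [of k n m, symmetric] lessThan_iff of_nat_add of_nat_mult)
    qed
    \<comment> \<open>The basis element at \<open>k = n\<close> is \<open>m choose Suc n\<close>,
      which accounts for the alternating term.\<close>
    also have "\<dots> + (- 1) ^ Suc n * int (m choose Suc n)
        = (\<Sum>k<Suc n. next_count n k * int ((m + Suc n - 1 - k) choose Suc n))"
      using sum_next_count [OF \<open>n \<ge> 1\<close>, of "\<lambda>k. int ((m + Suc n - 1 - k) choose Suc n)"] by simp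
    finally show ?thesis
      by (simp only: left_diff_distrib sum_subtractf)
  qed
  from binomial_combination_eq_0 [OF this \<open>k < Suc n\<close>] show ?thesis
    by simp
qed

section \<open>The homogenized polynomial and its recurrence\<close>

lemma descent_count_1: "descent_count 1 k = 0"
  by (auto simp: descent_count_def derangements_def)

lemma pderiv_sum: "pderiv (sum f A) = (\<Sum>a\<in>A. pderiv (f a))"
  by (induction A rule: infinite_finite_induct) (auto simp: pderiv_add)

lemma smult_of_nat_eq: "smult (of_nat m) p = of_nat m * p"
  by (simp add: of_nat_poly)

text \<open>
  In terms of the descent polynomial \<open>D\<close> this is \<open>z * x ^ n * D z\<close>, where \<open>x = 1 / (z - 1)\<close>.
\<close>
definition derangement_homog :: "nat \<Rightarrow> complex poly" where
  "derangement_homog n = (\<Sum>k<n. of_nat (descent_count n k) * (X ^ (n - 1 - k) * W ^ Suc k))"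

text \<open>The product rule on \<open>X ^ (n - k) * W ^ Suc k\<close> produces the two Eulerian
  weights \<open>Suc k\<close> and \<open>n - k\<close>.\<close>

lemma derangement_homog_Suc:
  assumes "n \<ge> 1"
  shows "derangement_homog (Suc n) = W * pderiv (X * derangement_homog n) + (- 1) ^ Suc n * W ^ Suc n"
proof -
  have "derangement_homog (Suc n) = (\<Sum>k<Suc n. of_int (next_count n k) * (X ^ (n - k) * W ^ Suc k))"
    unfolding derangement_homog_def using descent_count_Suc [OF assms] 
    by (intro sum.cong refl) (metis diff_Suc_1 lessThan_iff of_int_of_nat_eq)
  also have "\<dots> = (\<Sum>k<n. of_nat (descent_count n k) * (of_nat (Suc k) * (X ^ (n - k) * W ^ Suc k)
      + of_nat (n - k) * (X ^ (n - Suc k) * W ^ Suc (Suc k)))) + (- 1) ^ Suc n * W ^ Suc n"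
    by (subst sum_next_count [OF assms]) simp
  also have "(\<Sum>k<n. of_nat (descent_count n k) * (of_nat (Suc k) * (X ^ (n - k) * W ^ Suc k)
      + of_nat (n - k) * (X ^ (n - Suc k) * W ^ Suc (Suc k)))) = W * pderiv (X * derangement_homog n)"
    unfolding derangement_homog_def sum_distrib_left pderiv_sum
  proof (intro sum.cong refl)
    fix k assume "k \<in> {..<n}"
    then obtain d where "n = Suc (k + d)"
      using less_iff_Suc_add by auto
    then have d: "n - k = Suc d" "n - 1 - k = d" "n - Suc k = d"
      by auto
    have X_mult: "X * (of_nat (descent_count n k) * (X ^ d * W ^ Suc k))
        = of_nat (descent_count n k) * (X ^ Suc d * W ^ Suc k)"
      by (simp add: algebra_simps)
    then show "of_nat (descent_count n k) * (of_nat (Suc k) * (X ^ (n - k) * W ^ Suc k)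
      + of_nat (n - k) * (X ^ (n - Suc k) * W ^ Suc (Suc k)))
      = W * pderiv (X * (of_nat (descent_count n k) * (X ^ (n - 1 - k) * W ^ Suc k)))"
      unfolding d X_mult
      by (simp only: pderiv_mult pderiv_of_nat pderiv_power_Suc pderiv_X pderiv_W smult_of_nat_eq mult_1_right)
        (simp add: algebra_simps)
  qed
  finally show ?thesis .
qed

lemma derangement_homog_1: "derangement_homog 1 = 0"
  by (simp add: derangement_homog_def descent_count_1 [simplified])

lemma derangement_homog_2: "derangement_homog (Suc 1) = W\<^sup>2"
  unfolding derangement_homog_Suc [OF order_refl] derangement_homog_1 by (simp add: power2_eq_square)

text \<open>The alternating term is \<open>- W\<close> times its predecessor, which the previous
  recurrence expresses by \<open>derangement_homog\<close>; then
  \<open>W * pderiv (X * f) - W * f = nuop f\<close>.\<close>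

lemma derangement_homog_recurrence:
  assumes "n \<ge> 1"
  shows "derangement_homog (Suc (Suc n)) = nuop (derangement_homog (Suc n)) + bop (derangement_homog n)"
proof -
  have "derangement_homog (Suc (Suc n)) = W * pderiv (X * derangement_homog (Suc n)) + (- 1) ^ Suc (Suc n) * W ^ Suc (Suc n)"
    by (rule derangement_homog_Suc) simp
  also have "(- 1) ^ Suc (Suc n) * W ^ Suc (Suc n) = - W * (derangement_homog (Suc n) - W * pderiv (X * derangement_homog n))"
    unfolding derangement_homog_Suc [OF assms] by simp
  finally show ?thesis
    by (simp add: nuop_def bop_def pderiv_mult algebra_simps power2_eq_square)
qed

text \<open>The sum is the number of derangements, and \<open>T = 1\<close> in
  \<open>sum_next_count\<close> gives its classical recurrence.\<close>

lemma sum_descent_count_pos: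
  assumes "n \<ge> 2"
  shows "(\<Sum>k<n. descent_count n k) > 0"
proof -
  define s where "s n = (\<Sum>k<n. int (descent_count n k))" for n
  have rec: "s (Suc n) = int (Suc n) * s n + (- 1) ^ Suc n" if "n \<ge> 1" for n
  proof -
    have "s (Suc n) = (\<Sum>k<Suc n. of_int (next_count n k) * 1)"
      unfolding s_def using descent_count_Suc [OF that] by simp
    also have "\<dots> = (\<Sum>k<n. int (descent_count n k) * (int (Suc k) * 1 + int (n - k) * 1)) + (- 1) ^ Suc n * 1"
      by (rule sum_next_count [OF that])
    also have "(\<Sum>k<n. int (descent_count n k) * (int (Suc k) * 1 + int (n - k) * 1)) = int (Suc n) * s n"
      unfolding s_def sum_distrib_left by (intro sum.cong) auto
    finally show ?thesis
      by simp
  qed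
  have "s n \<ge> 1"
    using assms
  proof (induction n rule: dec_induct)
    case base
    then show ?case
      using rec [of 1] by (simp add: s_def descent_count_1 [simplified] numeral_2_eq_2)
  next
    case (step n)
    have "(- 1) ^ m \<ge> (- 1 :: int)" for m
      by (cases "even m") auto
    moreover have "int (Suc n) * s n \<ge> 2 * 1"
      using step by (intro mult_mono) auto
    ultimately show ?case
      using rec [of n] step(1) by (smt (verit) One_nat_def Suc_1 Suc_leD)
  qed
  then have "int (\<Sum>k<n. descent_count n k) > 0"
    unfolding s_def by simp
  then show ?thesis
    by (simp only: of_nat_0_less_iff)
qed

text \<open>Outside the segment \<open>x\<close> and \<open>x + 1\<close> are nonzero of equal sign,
  so all terms share one sign and cannot cancel.\<close>

lemma derangement_homog_real_root:
  assumes "n \<ge> 2" "poly (derangement_homog n) (of_real x) = 0"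
  shows "- 1 \<le> x \<and> x \<le> 0"
proof (rule ccontr)
  assume x: "\<not> (- 1 \<le> x \<and> x \<le> 0)"
  define a where "a k = real (descent_count n k) * (\<bar>x\<bar> ^ (n - 1 - k) * \<bar>x + 1\<bar> ^ Suc k)" for k
  have "poly (derangement_homog n) (of_real x) = of_real (\<Sum>k<n. real (descent_count n k) * (x ^ (n - 1 - k) * (x + 1) ^ Suc k))"
    by (simp add: derangement_homog_def poly_sum)
  then have 0: "(\<Sum>k<n. real (descent_count n k) * (x ^ (n - 1 - k) * (x + 1) ^ Suc k)) = 0"
    using assms(2) by (metis of_real_eq_0_iff)
  have "(\<Sum>k<n. a k) = 0"
  proof (cases "x > 0")
    case True
    then show ?thesis
      using 0 by (simp add: a_def)
  next
    case False
    then have neg: "\<bar>x\<bar> = - x" "\<bar>x + 1\<bar> = - (x + 1)"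
      using x by auto
    have "a k = (- 1) ^ n * (real (descent_count n k) * (x ^ (n - 1 - k) * (x + 1) ^ Suc k))" if "k < n" for k
    proof -
      have "(- 1 :: real) ^ n = (- 1) ^ (n - 1 - k) * (- 1) ^ Suc k"
        using that by (simp flip: power_add del: power_Suc)
      then show ?thesis
        unfolding a_def neg power_minus [of x] power_minus [of "x + 1"] by simp
    qed
    then show ?thesis
      using 0 by (simp flip: sum_distrib_left)
  qed
  moreover have "a k \<ge> 0" for k
    by (simp add: a_def)
  ultimately have "a k = 0" if "k < n" for k
    using that by (simp add: sum_nonneg_eq_0_iff)
  then have "descent_count n k = 0" if "k < n" for k
    using that x by (force simp: a_def)
  then have "(\<Sum>k<n. descent_count n k) = 0"
    by simp
  then show False
    using sum_descent_count_pos [OF assms(1)] by simp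
qed

lemma rooted_homog:
  assumes "n \<ge> 2"
  shows "rooted (derangement_homog n)"
proof -
  have "rooted (derangement_homog (Suc (n - 1)))"
  \<comment> \<open>The index is shifted by one because \<open>derangement_homog 1 = 0\<close>
    serves as \<open>G 0\<close>.\<close>
  proof (rule rooted_bop_nuop_recurrence [where G = "\<lambda>n. derangement_homog (Suc n)"])
    show "derangement_homog (Suc 0) = 0" "derangement_homog (Suc 1) = W\<^sup>2"
      using derangement_homog_1 derangement_homog_2 by simp_all
    show "derangement_homog (Suc (n + 2)) = nuop (derangement_homog (Suc (n + 1))) + bop (derangement_homog (Suc n))" for n
      using derangement_homog_recurrence [of "Suc n"] by simp
    show "- 1 \<le> x \<and> x \<le> 0" if "n \<ge> 1" "poly (derangement_homog (Suc n)) (of_real x) = 0" for n x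
      using derangement_homog_real_root [of "Suc n" x] that by simp
  qed (use assms in simp)
  then show ?thesis
    using assms by simp
qed

section \<open>Transfer to the zeros of the descent polynomial\<close>

theorem theorem2p1:
  fixes n :: nat
  assumes "n \<ge> 2"
  shows "\<forall>z::complex. poly (derangement_descent_poly n) z = 0 \<longrightarrow> z \<in> \<real> \<and> Re z \<le> 0"
proof (intro allI impI)
  fix z :: complex
  assume root: "poly (derangement_descent_poly n) z = 0"
  have D: "poly (derangement_descent_poly n) z = (\<Sum>k<n. of_nat (descent_count n k) * z ^ k)" for z :: complex
    using sum_derangements_des [of n "\<lambda>k. z ^ k"] assms
    by (simp add: derangement_descent_poly_def poly_sum poly_monom)
  \<comment> \<open>The value at 1 is the number of derangements, which is positive.\<close>
  have "z \<noteq> 1"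
  proof
    assume "z = 1"
    then have "of_nat (\<Sum>k<n. descent_count n k) = (0 :: complex)"
      using root D by simp
    then show False
      using sum_descent_count_pos [OF assms] by (simp only: of_nat_eq_0_iff)
  qed
  \<comment> \<open>With this choice \<open>x + 1 = z * x\<close>, so each summand of
    \<open>derangement_homog n\<close> at \<open>x\<close> is \<open>z * x ^ n\<close> times one of
    the descent polynomial at \<open>z\<close>.\<close>
  define x where "x = 1 / (z - 1)"
  have x: "x \<noteq> 0" "x + 1 = z * x"
    using \<open>z \<noteq> 1\<close> by (auto simp: x_def field_simps)
  have "poly (derangement_homog n) x = (\<Sum>k<n. z * x ^ n * (of_nat (descent_count n k) * z ^ k))"
  proof -
    have "x ^ (n - 1 - k) * (x + 1) ^ Suc k = z * x ^ n * z ^ k" if "k < n" for k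
    proof -
      have "x ^ n = x ^ (n - 1 - k) * x ^ Suc k"
        using that by (simp flip: power_add del: power_Suc)
      then show ?thesis
        by (simp add: x(2) power_mult_distrib)
    qed
    then show ?thesis
      unfolding derangement_homog_def by (simp add: poly_sum mult.left_commute del: power_Suc)
  qed
  also have "\<dots> = 0"
    using root D by (simp flip: sum_distrib_left)
  finally have "x \<in> unit_seg"
    using rooted_homog [OF assms] by (simp add: rooted_def)
  then obtain r where r: "x = of_real r" "- 1 \<le> r" "r < 0"
    using x(1) by (auto simp: unit_seg_def complex_eq_iff intro!: that [of "Re x"])
  have "z = 1 + 1 / x"
    using \<open>z \<noteq> 1\<close> by (simp add: x_def)
  then have "z = of_real (1 + 1 / r)"
    by (simp add: r)
  moreover have "1 + 1 / r \<le> 0"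
    using r by (simp add: field_simps)
  ultimately show "z \<in> \<real> \<and> Re z \<le> 0"
    by simp
qed

end
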